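(* Assume $\max A=b-1$ and let $s\in\mathbb{C}$ with $\operatorname{Re}s>\log_bN$. Then, as the real variable $m\to+\infty$, $$m^s u_m(s)=F_s(m)+O\!\left(\frac1m\right),$$ where $$F_s(m)=\frac{1}{\log b}\sum_{k=-\infty}^{\infty}e^{2\pi i k\log_b(m)}\,\Gamma\!\Bigl(s-\frac{2\pi i k}{\log b}\Bigr)\sum_{n\in\mathcal{B}}\frac{1}{(n+1)^{\,s-\frac{2\pi i k}{\log b}}}$$ is a smooth $1$-periodic function of $\log_b(m)$ (so $F_s(bm)=F_s(m)$), which can equivalently be written as $$F_s(m)=m^s\sum_{j=-\infty}^{\infty}b^{js}e^{-b^jm}\sum_{n\in\mathcal{B}}e^{-nb^jm}.$$ Moreover, for the integer moments, the asymptotic average exists and equals $$\lim_{p\to\infty}\ \sum_{\substack{m\in\mathbb{Z}\\ b^p<m\le b^{p+1}}} m^s u_m(s)\,\log_b\!\frac{m}{m-1}=\frac{\Gamma(s)}{\log b}\sum_{n\in\mathcal{B}}\frac{1}{(n+1)^s}.$$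
   Context: Let $b\ge 2$ be an integer and $A\subset\{0,1,\dots,b-1\}$ a nonempty set of digits with $N=\#A$ and $f=\max A>0$. For $s\in\mathbb{C}$ with $\operatorname{Re}s>\log_b N$, $\mu_s$ is the discrete complex Borel measure on $[0,1)$ $$\mu_s=\delta_0+\sum_{l=1}^{\infty}\ \sum_{(a_1,\dots,a_l)\in A^l} b^{-ls}\,\delta_{a_1b^{-1}+\cdots+a_lb^{-l}},$$ where $\delta_y$ denotes the unit Dirac mass at $y$, and for real $m\ge0$ its moments are $$u_m(s)=\int_{[0,1)}x^m\,\mu_s(dx)=0^m+\sum_{l=1}^\infty\sum_{(a_1,\dots,a_l)\in A^l}\bigl(a_1b^{-1}+\cdots+a_lb^{-l}\bigr)^m b^{-ls}\quad(0^0=1).$$ Let $B=\{f-a: a\in A\}$ and let $\mathcal{B}$ be the set of non-negative integers whose radix-$b$ representation uses only digits from $B$ (the integer $0$, represented by the empty word, always belongs to $\mathcal{B}$). Powers $m^s$, $(n+1)^w$ use the principal branch $e^{s\log m}$, and $\Gamma$ is Euler's Gamma function. *)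

theory Defs
  imports "HOL-Analysis.Analysis" "HOL-Library.Landau_Symbols"
begin

definition digit_val :: "nat \<Rightarrow> nat list \<Rightarrow> real" where
  "digit_val b as = (\<Sum>i<length as. real (as ! i) / real b ^ Suc i)"

definition words :: "nat set \<Rightarrow> nat \<Rightarrow> nat list set" where
  "words A l = {as. length as = l \<and> set as \<subseteq> A}"

definition rpow0 :: "real \<Rightarrow> real \<Rightarrow> real" where
  "rpow0 x m = (if m = 0 then 1 else x powr m)"

definition moment :: "nat \<Rightarrow> nat set \<Rightarrow> real \<Rightarrow> complex \<Rightarrow> complex" where
  "moment b A m s =
     complex_of_real (rpow0 0 m) +
     (\<Sum>l. \<Sum>as\<in>words A (Suc l).
        complex_of_real (rpow0 (digit_val b as) m) * (of_nat b) powr (- (of_nat (Suc l) * s)))"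

text \<open>Non-negative integers whose radix-b representation uses only digits from D
  (the digits of n are (n div b^k) mod b for those k with n div b^k \<noteq> 0; 0 always qualifies).\<close>
definition radix_set :: "nat \<Rightarrow> nat set \<Rightarrow> nat set" where
  "radix_set b D = {n. \<forall>k. n div b ^ k \<noteq> 0 \<longrightarrow> (n div b ^ k) mod b \<in> D}"

definition calB :: "nat \<Rightarrow> nat set \<Rightarrow> nat set" where
  "calB b A = radix_set b ((\<lambda>a. Max A - a) ` A)"

definition wk :: "nat \<Rightarrow> complex \<Rightarrow> int \<Rightarrow> complex" where
  "wk b s k = s - 2 * of_real pi * \<i> * of_int k / of_real (ln (real b))"

definition F1 :: "nat \<Rightarrow> nat set \<Rightarrow> complex \<Rightarrow> real \<Rightarrow> complex" where
  "F1 b A s m = (1 / of_real (ln (real b))) *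
     (\<Sum>\<^sub>\<infinity>k\<in>(UNIV::int set).
        exp (2 * of_real pi * \<i> * of_int k * of_real (log (real b) m)) * Gamma (wk b s k) *
        (\<Sum>\<^sub>\<infinity>n\<in>calB b A. (of_nat n + 1) powr (- wk b s k)))"

definition F2 :: "nat \<Rightarrow> nat set \<Rightarrow> complex \<Rightarrow> real \<Rightarrow> complex" where
  "F2 b A s m = (complex_of_real m) powr s *
     (\<Sum>\<^sub>\<infinity>j\<in>(UNIV::int set).
        (of_nat b) powr (of_int j * s) * complex_of_real (exp (- (real b powr of_int j * m))) *
        (\<Sum>\<^sub>\<infinity>n\<in>calB b A. complex_of_real (exp (- (real n * real b powr of_int j * m)))))"

end

theory Submission
  imports Defs
begin

text \<open>
  Write \<open>\<beta> = ln b\<close>. Since \<open>Max A = b - 1\<close>, the points of the measure at level \<open>l\<close> are exactly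
  \<open>1 - (n + 1) / b ^ l\<close> with \<open>n < b ^ l\<close> in \<open>calB b A\<close>, so the moment is a double sum over levels \<open>l\<close>
  and \<open>n\<close> of \<open>(1 - y) powr m\<close> with \<open>y = (n + 1) / b ^ l\<close>. Replacing \<open>(1 - y) powr m\<close> by \<open>exp (- m * y)\<close>
  costs at most \<open>4 * (m * y)\<^sup>2 * exp (- m * y) / m\<close>, and turns the double sum into \<open>F2\<close>; the bilateral
  sum over \<open>l\<close> of the error terms is bounded uniformly in \<open>(n + 1) * m\<close>, which gives the \<open>1 / m\<close> rate.

  Summing over \<open>l\<close> first, \<open>F2\<close> is the sum over \<open>n\<close> of \<open>(n + 1) powr - s\<close> times the periodic function
  \<open>scale_sum \<beta> s\<close> at \<open>log b ((n + 1) * m)\<close>. Unfolding the period, its \<open>k\<close>-th Fourier coefficient is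
  Euler's integral for \<open>Gamma (wk b s k) / \<beta>\<close>, so its Fourier expansion yields \<open>F1 = F2\<close>. The functional
  equation and \<open>norm (Gamma z) \<le> Gamma (Re z)\<close> make these coefficients decay faster than any power of
  \<open>k\<close>, hence smoothness. The averages are Riemann sums of \<open>F1\<close> over one period in \<open>log b m\<close>, and pick out
  the constant term of the series.
\<close>

section \<open>Fourier series of differentiable periodic functions\<close>

definition character :: "int \<Rightarrow> real \<Rightarrow> complex" where
  "character k t = exp (2 * of_real pi * \<i> * of_int k * of_real t)"

lemma norm_character [simp]: "norm (character k t) = 1"
  by (simp add: character_def)

lemma character_0 [simp]: "character 0 t = 1"
  by (simp add: character_def)

lemma character_add: "character (k + l) t = character k t * character l t"
  by (simp add: character_def exp_add [symmetric] algebra_simps)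

lemma character_arg_add: "character k (t + u) = character k t * character k u"
  by (simp add: character_def exp_add [symmetric] algebra_simps)

lemma character_uminus: "character (- k) t = cnj (character k t)"
  by (simp add: character_def exp_cnj)

lemma character_mult_cnj [simp]: "character k t * cnj (character k t) = 1"
  by (simp add: complex_norm_square [symmetric])

lemma character_of_int [simp]: "character k (of_int n) = 1"
  unfolding character_def exp_eq_1 by (auto intro!: exI[of _ "k * n"])

lemma character_at_0 [simp]: "character k 0 = 1"
  by (simp add: character_def)

lemma character_at_1 [simp]: "character k 1 = 1"
  using character_of_int[of k 1] by simp

lemma character_has_vector_derivative:
  "(character k has_vector_derivative (2 * of_real pi * \<i> * of_int k * character k t)) (at t within S)"
  using exp_scaleR_has_vector_derivative_right[of "2 * of_real pi * \<i> * of_int k" t S]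
  by (simp add: character_def[abs_def] scaleR_conv_of_real mult_ac)

lemma continuous_on_character [continuous_intros]: "continuous_on S (character k)"
  unfolding character_def by (intro continuous_intros)

lemma integral_character:
  "integral {0..1} (character k) = (if k = 0 then 1 else 0)"
proof (cases "k = 0")
  case False
  let ?w = "2 * of_real pi * \<i> * of_int k :: complex"
  have "(character k has_integral (character k 1 / ?w - character k 0 / ?w)) {0..1}"
  proof (rule fundamental_theorem_of_calculus)
    show "((\<lambda>t. character k t / ?w) has_vector_derivative character k t) (at t within {0..1})" for t
      using has_vector_derivative_divide[OF character_has_vector_derivative[of k t "{0..1}"], of ?w] False by simp
  qed simp
  with False show ?thesis by (simp add: integral_unique)
next
  case True
  have "character 0 = (\<lambda>_. 1)" by (auto simp: fun_eq_iff)
  with True show ?thesis by simp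
qed

section \<open>Fourier coefficients, Bessel's inequality and pointwise convergence\<close>

definition fourier_coeff :: "(real \<Rightarrow> complex) \<Rightarrow> int \<Rightarrow> complex" where
  "fourier_coeff f k = integral {0..1} (\<lambda>t. f t * character (- k) t)"

text \<open>Induction on \<open>K\<close>: subtracting from \<open>f\<close> its component along
  \<open>character l\<close> leaves the other coefficients unchanged, by orthogonality, and lowers
  the integral of \<open>(norm (f t))\<^sup>2\<close> by exactly the square of the removed
  coefficient. Hence \<open>f\<close> varies in the induction.\<close>

lemma bessel_inequality:
  assumes "finite K" and "continuous_on {0..1} f"
  shows "(\<Sum>k\<in>K. (norm (fourier_coeff f k))\<^sup>2) \<le> integral {0..1} (\<lambda>t. (norm (f t))\<^sup>2)"
  using assms
proof (induction K arbitrary: f rule: finite_induct)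
  case empty
  show ?case by (simp add: integral_nonneg integrable_continuous_real continuous_intros empty)
next
  case (insert l K)
  note [continuous_intros] = insert.prems
  define a where "a = fourier_coeff f l"
  define g where "g t = f t - a * character l t" for t
  have contg: "continuous_on {0..1} g"
    unfolding g_def by (intro continuous_intros)
  have coeff: "fourier_coeff g k = fourier_coeff f k" if "k \<in> K" for k
  proof -
    have "fourier_coeff g k = integral {0..1} (\<lambda>t. f t * character (- k) t - a * character (l - k) t)"
      unfolding fourier_coeff_def g_def using character_add[of l "- k"]
      by (simp add: algebra_simps)
    also have "\<dots> = fourier_coeff f k - a * integral {0..1} (character (l - k))"
      unfolding fourier_coeff_def
      by (subst Henstock_Kurzweil_Integration.integral_diff)
         (auto intro!: integrable_continuous_real continuous_intros)
    also have "integral {0..1} (character (l - k)) = 0"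
      using insert.hyps that by (auto simp: integral_character)
    finally show ?thesis by simp
  qed
  have point: "(norm (g t))\<^sup>2 = (norm (f t))\<^sup>2 - 2 * Re (cnj a * (f t * character (- l) t)) + (norm a)\<^sup>2" for t
  proof -
    have "complex_of_real ((norm (g t))\<^sup>2) = g t * cnj (g t)"
      by (simp only: complex_norm_square)
    also have "\<dots> = f t * cnj (f t) - (cnj a * (f t * character (- l) t) + cnj (cnj a * (f t * character (- l) t)))
                  + a * cnj a * (character l t * cnj (character l t))"
      by (simp add: g_def character_uminus algebra_simps del: character_mult_cnj)
    also have "\<dots> = complex_of_real ((norm (f t))\<^sup>2 - 2 * Re (cnj a * (f t * character (- l) t)) + (norm a)\<^sup>2)"
      by (simp only: complex_norm_square complex_add_cnj of_real_add of_real_diff)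
         simp
    finally show ?thesis by (simp only: of_real_eq_iff)
  qed
  have "((\<lambda>t. f t * character (- l) t) has_integral a) {0..1}"
    unfolding a_def fourier_coeff_def
    by (intro integrable_integral integrable_continuous_real continuous_intros)
  hence "((\<lambda>t. Re (cnj a * (f t * character (- l) t))) has_integral Re (cnj a * a)) {0..1}"
    by (intro has_integral_Re has_integral_mult_right)
  hence re: "((\<lambda>t. 2 * Re (cnj a * (f t * character (- l) t))) has_integral 2 * (norm a)\<^sup>2) {0..1}"
    by (intro has_integral_mult_right)
       (simp add: complex_norm_square[symmetric] mult.commute[of "cnj a" a] del: of_real_power)
  have "((\<lambda>t. (norm (g t))\<^sup>2) has_integral
          (integral {0..1} (\<lambda>t. (norm (f t))\<^sup>2) - 2 * (norm a)\<^sup>2 + (norm a)\<^sup>2 * (1 - 0))) {0..1}"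
    unfolding point
    by (intro has_integral_add has_integral_diff re integrable_integral integrable_continuous_real
          continuous_intros)
       (use has_integral_const_real[of "(norm a)\<^sup>2" 0 1] in simp)
  hence "integral {0..1} (\<lambda>t. (norm (g t))\<^sup>2) = integral {0..1} (\<lambda>t. (norm (f t))\<^sup>2) - (norm a)\<^sup>2"
    by (simp add: integral_unique)
  moreover have "(\<Sum>k\<in>K. (norm (fourier_coeff f k))\<^sup>2) \<le> integral {0..1} (\<lambda>t. (norm (g t))\<^sup>2)"
    using insert.IH[OF contg] coeff by simp
  ultimately show ?case using insert.hyps by (simp add: a_def)
qed

text \<open>A Riemann-Lebesgue lemma: Bessel's inequality bounds the partial sums of the squared
  coefficients along any enumeration without repetition. A general \<open>g\<close> serves both
  tails, \<open>int n\<close> and \<open>- int (Suc n)\<close>.\<close>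

lemma fourier_coeff_tendsto_0:
  assumes "continuous_on {0..1} f"
    and "inj g"
  shows "(\<lambda>n::nat. fourier_coeff f (g n)) \<longlonglongrightarrow> 0"
proof -
  have "summable (\<lambda>n. (norm (fourier_coeff f (g n)))\<^sup>2)"
  proof (rule summableI_nonneg_bounded)
    fix n
    have "(\<Sum>i<n. (norm (fourier_coeff f (g i)))\<^sup>2) = (\<Sum>k\<in>g ` {..<n}. (norm (fourier_coeff f k))\<^sup>2)"
      using assms(2) by (subst sum.reindex) (auto simp: inj_def inj_on_def)
    also have "\<dots> \<le> integral {0..1} (\<lambda>t. (norm (f t))\<^sup>2)"
      by (rule bessel_inequality) (use assms in auto)
    finally show "(\<Sum>i<n. (norm (fourier_coeff f (g i)))\<^sup>2) \<le> integral {0..1} (\<lambda>t. (norm (f t))\<^sup>2)" .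
  qed simp
  from summable_LIMSEQ_zero[OF this] have "(\<lambda>n. sqrt ((norm (fourier_coeff f (g n)))\<^sup>2)) \<longlonglongrightarrow> sqrt 0"
    by (rule tendsto_real_sqrt)
  thus ?thesis by (simp add: tendsto_norm_zero_iff)
qed

text \<open>One-sided l'Hopital rule at a common zero: \<open>f t / g t\<close> is the quotient of
  the two difference quotients at \<open>x\<close>. Limits within \<open>S\<close> allow for the end
  points of \<open>{0..1}\<close>.\<close>

lemma divide_tendsto_derivatives:
  fixes f g :: "real \<Rightarrow> complex"
  assumes f: "(f has_vector_derivative f') (at x within S)" "f x = 0"
    and g: "(g has_vector_derivative g') (at x within S)" "g x = 0" "g' \<noteq> 0"
  shows "((\<lambda>t. f t / g t) \<longlongrightarrow> f' / g') (at x within S)"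
proof -
  have slope: "((\<lambda>t. (h t - h x) /\<^sub>R (t - x)) \<longlongrightarrow> h') (at x within S)"
    if h: "(h has_vector_derivative h') (at x within S)" for h :: "real \<Rightarrow> complex" and h'
  proof -
    have "((\<lambda>t. norm (h t - h x - (t - x) *\<^sub>R h') / norm (t - x)) \<longlongrightarrow> 0) (at x within S)"
      using h unfolding has_vector_derivative_def has_derivative_iff_norm by blast
    moreover have "eventually (\<lambda>t. norm (h t - h x - (t - x) *\<^sub>R h') / norm (t - x)
                     = norm ((h t - h x) /\<^sub>R (t - x) - h')) (at x within S)"
    proof (intro eventually_at_topological[THEN iffD2] exI[of _ UNIV] conjI ballI impI)
      fix t assume "t \<noteq> x"
      hence "(h t - h x) /\<^sub>R (t - x) - h' = (h t - h x - (t - x) *\<^sub>R h') /\<^sub>R (t - x)"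
        by (simp add: scaleR_diff_right)
      thus "norm (h t - h x - (t - x) *\<^sub>R h') / norm (t - x) = norm ((h t - h x) /\<^sub>R (t - x) - h')"
        by (simp add: divide_inverse mult.commute)
    qed auto
    ultimately have "((\<lambda>t. norm ((h t - h x) /\<^sub>R (t - x) - h')) \<longlongrightarrow> 0) (at x within S)"
      by (rule Lim_transform_eventually)
    thus ?thesis by (simp add: tendsto_norm_zero_iff Lim_null[symmetric])
  qed
  have "((\<lambda>t. ((f t - f x) /\<^sub>R (t - x)) / ((g t - g x) /\<^sub>R (t - x))) \<longlongrightarrow> f' / g') (at x within S)"
    by (intro tendsto_divide slope f g)
  moreover have "eventually (\<lambda>t. ((f t - f x) /\<^sub>R (t - x)) / ((g t - g x) /\<^sub>R (t - x)) = f t / g t) (at x within S)"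
    by (intro eventually_at_topological[THEN iffD2] exI[of _ UNIV])
       (auto simp: f g scaleR_conv_of_real)
  ultimately show ?thesis by (rule Lim_transform_eventually)
qed

lemma character_1_eq_1_iff:
  assumes "0 \<le> t" "t \<le> 1"
  shows "character 1 t = 1 \<longleftrightarrow> t = 0 \<or> t = 1"
proof
  assume "character 1 t = 1"
  then obtain n :: int where "2 * pi * t = of_int (2 * n) * pi"
    by (auto simp: character_def exp_eq_1)
  hence "t = of_int n" by simp
  with assms show "t = 0 \<or> t = 1" by auto
qed auto

text \<open>Chernoff's argument: dividing \<open>h - h 0\<close> by \<open>character 1 - 1\<close> turns the partial sums of the
  Fourier series at 0 into telescoping sums, and Bessel's inequality kills the boundary terms.\<close>

lemma fourier_series_at_0:
  assumes cont: "continuous_on {0..1} h" and per: "h 1 = h 0"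
    and d0: "(h has_vector_derivative d0) (at 0 within {0..1})"
    and d1: "(h has_vector_derivative d1) (at 1 within {0..1})"
    and sum: "(fourier_coeff h has_sum S) UNIV"
  shows "S = h 0"
proof -
  define u where "u t = character 1 t - 1" for t
  have u0: "u t = 0 \<longleftrightarrow> t = 0 \<or> t = 1" if "t \<in> {0..1}" for t
    using character_1_eq_1_iff[of t] that by (auto simp: u_def)
  have du: "(u has_vector_derivative 2 * of_real pi * \<i> * character 1 t) (at t within {0..1})" for t
    unfolding u_def using has_vector_derivative_diff_const[of "character 1" 1] character_has_vector_derivative[of 1]
    by simp
  define c where "c = 2 * complex_of_real pi * \<i>"
  \<comment> \<open>\<open>c\<close> is the derivative of \<open>u\<close> at both of its zeros 0
    and 1, so these end point values make the quotient continuous.\<close>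
  define f where "f t = (if t = 0 then d0 / c else if t = 1 then d1 / c else (h t - h 0) / u t)" for t
  have contf: "continuous_on {0..1} f"
    unfolding continuous_on_def
  proof
    fix t :: real assume t: "t \<in> {0..1}"
    have lim: "((\<lambda>t. (h t - h 0) / u t) \<longlongrightarrow> f t) (at t within {0..1})"
    proof -
      consider "t = 0" | "t = 1" | "t \<noteq> 0" "t \<noteq> 1" by blast
      thus ?thesis
      proof cases
        case 1
        have "((\<lambda>t. (h t - h 0) / u t) \<longlongrightarrow> d0 / c) (at 0 within {0..1})"
          by (rule divide_tendsto_derivatives)
             (use d0 du[of 0] u0[of 0] in \<open>auto simp: c_def has_vector_derivative_diff_const\<close>)
        with 1 show ?thesis by (simp add: f_def)
      next
        case 2
        have "((\<lambda>t. (h t - h 0) / u t) \<longlongrightarrow> d1 / c) (at 1 within {0..1})"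
          by (rule divide_tendsto_derivatives)
             (use d1 du[of 1] u0[of 1] per in \<open>auto simp: c_def has_vector_derivative_diff_const\<close>)
        with 2 show ?thesis by (simp add: f_def)
      next
        case 3
        have "(h \<longlongrightarrow> h t) (at t within {0..1})"
          using cont t by (simp add: continuous_on_def)
        moreover have "(u \<longlongrightarrow> u t) (at t within {0..1})"
          using du[of t] has_vector_derivative_continuous continuous_within by blast
        ultimately have "((\<lambda>t. (h t - h 0) / u t) \<longlongrightarrow> (h t - h 0) / u t) (at t within {0..1})"
          using u0[OF t] 3 by (intro tendsto_intros) auto
        with 3 show ?thesis by (simp add: f_def)
      qed
    qed
    \<comment> \<open>Away from \<open>t\<close> itself, \<open>f\<close> can differ from the
      quotient only at 0 and 1; removing whichever of them is not \<open>t\<close> leaves a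
      neighbourhood of \<open>t\<close>.\<close>
    have "open (- ({0,1} - {t}))" by (intro open_Compl finite_imp_closed) auto
    hence "eventually (\<lambda>x. (h x - h 0) / u x = f x) (at t within {0..1})"
      unfolding eventually_at_topological
      by (intro exI[of _ "- ({0,1} - {t})"]) (auto simp: f_def)
    with lim show "(f \<longlongrightarrow> f t) (at t within {0..1})"
      by (rule Lim_transform_eventually)
  qed
  note [continuous_intros] = contf cont
  have eq: "f t * u t = h t - h 0" if "t \<in> {0..1}" for t
    using u0[OF that] per by (auto simp: f_def u_def)
  \<comment> \<open>Multiplication by \<open>character 1\<close> shifts the coefficient index by
    one, so \<open>f t * u t = h t - h 0\<close> makes each coefficient of \<open>h\<close> a
    difference of neighbouring coefficients of \<open>f\<close>; the constant \<open>h 0\<close>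
    affects index 0 only.\<close>
  have coeff: "fourier_coeff h k - (if k = 0 then h 0 else 0) = fourier_coeff f (k - 1) - fourier_coeff f k" for k
  proof -
    have "fourier_coeff h k - h 0 * integral {0..1} (character (- k))
          = integral {0..1} (\<lambda>t. h t * character (- k) t - h 0 * character (- k) t)"
      unfolding fourier_coeff_def
      by (subst Henstock_Kurzweil_Integration.integral_diff)
         (auto intro!: integrable_continuous_real continuous_intros)
    also have "\<dots> = integral {0..1} (\<lambda>t. f t * character (- (k - 1)) t - f t * character (- k) t)"
    proof (rule Henstock_Kurzweil_Integration.integral_cong)
      fix t :: real assume "t \<in> {0..1}"
      have "h t * character (- k) t - h 0 * character (- k) t = (f t * u t) * character (- k) t"
        by (simp only: eq[OF \<open>t \<in> {0..1}\<close>] left_diff_distrib)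
      also have "\<dots> = f t * character (- (k - 1)) t - f t * character (- k) t"
        using character_add[of 1 "- k" t] by (simp add: u_def algebra_simps)
      finally show "h t * character (- k) t - h 0 * character (- k) t
                      = f t * character (- (k - 1)) t - f t * character (- k) t" .
    qed
    also have "\<dots> = fourier_coeff f (k - 1) - fourier_coeff f k"
      unfolding fourier_coeff_def
      by (subst Henstock_Kurzweil_Integration.integral_diff)
         (auto intro!: integrable_continuous_real continuous_intros)
    finally show ?thesis by (cases "k = 0") (simp_all add: integral_character)
  qed
  have partial: "sum (fourier_coeff h) {- int n..int n}
                   = h 0 + (fourier_coeff f (- int (Suc n)) - fourier_coeff f (int n))" for n
  proof (induction n)
    case 0
    show ?case using coeff[of 0] by (simp add: algebra_simps)
  next
    case (Suc n)
    have "{- int (Suc n)..int (Suc n)} = insert (- int (Suc n)) (insert (int (Suc n)) {- int n..int n})"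
      by auto
    moreover have "fourier_coeff h (int (Suc n)) = fourier_coeff f (int n) - fourier_coeff f (int (Suc n))"
      using coeff[of "int (Suc n)"] by simp
    moreover have "fourier_coeff h (- int (Suc n)) = fourier_coeff f (- int (Suc (Suc n))) - fourier_coeff f (- int (Suc n))"
      using coeff[of "- int (Suc n)"] by (simp add: algebra_simps)
    ultimately show ?case using Suc by simp
  qed
  \<comment> \<open>The symmetric intervals eventually contain every finite index set, so the
    symmetric partial sums converge to the unordered sum \<open>S\<close>.\<close>
  have "filterlim (\<lambda>n. {- int n..int n}) (finite_subsets_at_top UNIV) sequentially"
    unfolding filterlim_finite_subsets_at_top
  proof (intro allI impI)
    fix X :: "int set" assume "finite X \<and> X \<subseteq> UNIV"
    then obtain N where N: "\<And>x. x \<in> X \<Longrightarrow> nat \<bar>x\<bar> \<le> N"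
      using finite_nat_set_iff_bounded_le[of "(\<lambda>x. nat \<bar>x\<bar>) ` X"] by auto
    have "X \<subseteq> {- int n..int n}" if "n \<ge> N" for n
      using N that by fastforce
    thus "eventually (\<lambda>n. finite {- int n..int n} \<and> X \<subseteq> {- int n..int n} \<and> {- int n..int n} \<subseteq> UNIV) sequentially"
      by (auto simp: eventually_sequentially)
  qed
  from filterlim_compose[OF sum[unfolded has_sum_def] this]
  have "(\<lambda>n. sum (fourier_coeff h) {- int n..int n}) \<longlonglongrightarrow> S" .
  moreover have "(\<lambda>n. h 0 + (fourier_coeff f (- int (Suc n)) - fourier_coeff f (int n))) \<longlonglongrightarrow> h 0 + (0 - 0)"
    by (intro tendsto_intros fourier_coeff_tendsto_0 contf) (auto simp: inj_def)
  ultimately show ?thesis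
    unfolding partial using LIMSEQ_unique by fastforce
qed

section \<open>Periodization over the powers of the base\<close>

lemma summable_on_comparison_complex:
  fixes f :: "'a \<Rightarrow> complex"
  assumes "g summable_on A" and "\<And>x. x \<in> A \<Longrightarrow> norm (f x) \<le> g x"
  shows "f summable_on A"
  using Infinite_Sum.abs_summable_on_comparison_test'[OF assms] by (rule abs_summable_summable)

text \<open>The integers are enumerated by \<open>int_decode\<close>, so that the theorem on
  termwise differentiation of sequential series applies; the majorant \<open>M\<close> gives uniform
  convergence of the differentiated series by the Weierstrass test.\<close>

lemma has_vector_derivative_infsum_int:
  fixes f :: "int \<Rightarrow> real \<Rightarrow> complex"
  assumes S: "convex S" "open S" "t \<in> S"
    and deriv: "\<And>k u. u \<in> S \<Longrightarrow> (f k has_vector_derivative f' k u) (at u)"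
    and bound: "\<And>k u. u \<in> S \<Longrightarrow> norm (f' k u) \<le> M k" "M summable_on UNIV"
    and summable: "\<And>u. u \<in> S \<Longrightarrow> (\<lambda>k. f k u) summable_on UNIV"
  shows "((\<lambda>u. \<Sum>\<^sub>\<infinity>k. f k u) has_vector_derivative (\<Sum>\<^sub>\<infinity>k. f' k t)) (at t)"
proof -
  let ?d = int_decode
  have reindex: "((\<lambda>n. g (?d n)) has_sum (\<Sum>\<^sub>\<infinity>k. g k)) UNIV" if "g summable_on UNIV"
    for g :: "int \<Rightarrow> 'b :: {comm_monoid_add,t2_space}"
    using has_sum_reindex_bij_betw[OF bij_int_decode, of g] has_sum_infsum[OF that] by simp
  have sums: "(\<lambda>n. f (?d n) u) sums (\<Sum>\<^sub>\<infinity>k. f k u)" if "u \<in> S" for u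
    using reindex[OF summable[OF that]] by (rule has_sum_imp_sums)
  have summable': "(\<lambda>k. f' k u) summable_on UNIV" if "u \<in> S" for u
    using bound(2) bound(1)[OF that] by (rule summable_on_comparison_complex)
  have sums': "(\<lambda>n. f' (?d n) u) sums (\<Sum>\<^sub>\<infinity>k. f' k u)" if "u \<in> S" for u
    using reindex[OF summable'[OF that]] by (rule has_sum_imp_sums)
  have "summable (\<lambda>n. M (?d n))"
    using has_sum_imp_sums[OF reindex[OF bound(2)]] by (rule sums_summable)
  hence "uniform_limit S (\<lambda>n u. \<Sum>i<n. f' (?d i) u) (\<lambda>u. \<Sum>i. f' (?d i) u) sequentially"
    using bound(1) by (intro Weierstrass_m_test) auto
  hence unif: "uniform_limit S (\<lambda>n u. \<Sum>i<n. f' (?d i) u) (\<lambda>u. \<Sum>\<^sub>\<infinity>k. f' k u) sequentially"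
    by (rule uniform_limit_cong'[THEN iffD1, rotated 2]) (use sums' sums_unique in fastforce)+
  have "\<exists>g. \<forall>u\<in>S. (\<lambda>n. f (?d n) u) sums g u \<and>
          (g has_derivative (\<lambda>h. h *\<^sub>R (\<Sum>\<^sub>\<infinity>k. f' k u))) (at u within S)"
  proof (rule has_derivative_series[where x = t and f' = "\<lambda>n u h. h *\<^sub>R f' (?d n) u"])
    fix e :: real assume "e > 0"
    with unif have "eventually (\<lambda>n. \<forall>u\<in>S. dist (\<Sum>i<n. f' (?d i) u) (\<Sum>\<^sub>\<infinity>k. f' k u) < e) sequentially"
      by (simp add: uniform_limit_iff)
    thus "eventually (\<lambda>n. \<forall>u\<in>S. \<forall>h. norm ((\<Sum>i<n. h *\<^sub>R f' (?d i) u) - h *\<^sub>R (\<Sum>\<^sub>\<infinity>k. f' k u)) \<le> e * norm h) sequentially"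
    proof (rule eventually_mono, intro ballI allI)
      fix n u and h :: real assume "\<forall>u\<in>S. dist (\<Sum>i<n. f' (?d i) u) (\<Sum>\<^sub>\<infinity>k. f' k u) < e" "u \<in> S"
      hence "norm ((\<Sum>i<n. f' (?d i) u) - (\<Sum>\<^sub>\<infinity>k. f' k u)) \<le> e"
        by (auto simp: dist_norm less_imp_le)
      thus "norm ((\<Sum>i<n. h *\<^sub>R f' (?d i) u) - h *\<^sub>R (\<Sum>\<^sub>\<infinity>k. f' k u)) \<le> e * norm h"
        by (simp add: scaleR_sum_right[symmetric] scaleR_diff_right[symmetric] mult.commute[of e] mult_left_mono)
    qed
  qed (use S deriv sums in \<open>auto simp: has_vector_derivative_def intro: has_derivative_at_withinI\<close>)
  then obtain g where g: "\<And>u. u \<in> S \<Longrightarrow> (\<lambda>n. f (?d n) u) sums g u"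
      "\<And>u. u \<in> S \<Longrightarrow> (g has_vector_derivative (\<Sum>\<^sub>\<infinity>k. f' k u)) (at u within S)"
    unfolding has_vector_derivative_def by blast
  have "g u = (\<Sum>\<^sub>\<infinity>k. f k u)" if "u \<in> S" for u
    using g(1)[OF that] sums[OF that] by (rule sums_unique2)
  with g(2)[OF S(3)] S(2,3) show ?thesis
    by (metis (no_types, lifting) at_within_open has_vector_derivative_transform_within_open)
qed

lemma summable_on_int_split:
  fixes f :: "int \<Rightarrow> real"
  assumes "summable (\<lambda>n. f (int n))" "summable (\<lambda>n. f (- int n))" "\<And>k. f k \<ge> 0"
  shows "f summable_on UNIV"
proof -
  have "f summable_on range int"
    using assms by (subst summable_on_reindex) (auto simp: o_def intro: summable_nonneg_imp_summable_on)
  moreover have "f summable_on range (\<lambda>n. - int n)"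
    using assms by (subst summable_on_reindex) (auto simp: o_def inj_def intro: summable_nonneg_imp_summable_on)
  ultimately have "f summable_on range int \<union> range (\<lambda>n. - int n)"
    by (rule summable_on_union)
  also have "range int \<union> range (\<lambda>n. - int n) = UNIV"
    by (auto intro: int_cases2)
  finally show ?thesis .
qed

lemma exp_abs_summable_on_int:
  fixes c :: real
  assumes "c > 0"
  shows "(\<lambda>k::int. exp (- c * \<bar>of_int k\<bar>)) summable_on UNIV"
proof -
  have "summable (\<lambda>n. exp (- c) ^ n)" using assms by (auto simp: summable_geometric_iff)
  hence "summable (\<lambda>n. exp (- c * real n))" by (simp add: exp_of_nat_mult[symmetric] mult.commute)
  thus ?thesis by (intro summable_on_int_split) auto
qed

text \<open>\<open>scale_kernel \<beta> z u\<close> is \<open>x\<^sup>z e\<^sup>-\<^sup>x\<close> at \<open>x = e\<^sup>\<beta>\<^sup>u\<close>.\<close>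

definition scale_kernel :: "real \<Rightarrow> complex \<Rightarrow> real \<Rightarrow> complex" where
  "scale_kernel \<beta> z u = exp (of_real (\<beta> * u) * z - of_real (exp (\<beta> * u)))"

text \<open>With \<open>\<beta> = ln b\<close> and \<open>t = log b x\<close> this is the sum over
  all integers \<open>j\<close> of \<open>y\<^sup>z e\<^sup>-\<^sup>y\<close> at
  \<open>y = b powr j * x\<close>, which is invariant under replacing \<open>x\<close> by
  \<open>b * x\<close>.\<close>

definition scale_sum :: "real \<Rightarrow> complex \<Rightarrow> real \<Rightarrow> complex" where
  "scale_sum \<beta> z t = (\<Sum>\<^sub>\<infinity>j::int. scale_kernel \<beta> z (of_int j + t))"

lemma norm_scale_kernel: "norm (scale_kernel \<beta> z u) = exp (\<beta> * u * Re z - exp (\<beta> * u))"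
  by (simp add: scale_kernel_def)

lemma scale_kernel_mult_exp:
  "exp (of_real (\<beta> * u) * w) * scale_kernel \<beta> z u = scale_kernel \<beta> (z + w) u"
  by (simp add: scale_kernel_def exp_add[symmetric] algebra_simps)

text \<open>For \<open>u < 0\<close> the factor \<open>exp (\<beta> * u * Re z)\<close> decays by
  itself. For \<open>u \<ge> 0\<close> the quadratic Taylor bound of
  \<open>exp (\<beta> * u)\<close> wins: \<open>2 * (Re z)\<^sup>2\<close> is the maximum of
  \<open>2 * x * Re z - x\<^sup>2 / 2\<close>.\<close>

lemma norm_scale_kernel_le:
  assumes "\<beta> > 0" "Re z > 0"
  shows "norm (scale_kernel \<beta> z u) \<le> exp (2 * (Re z)\<^sup>2) * exp (- (\<beta> * Re z) * \<bar>u\<bar>)"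
proof -
  have "\<beta> * u * Re z - exp (\<beta> * u) \<le> 2 * (Re z)\<^sup>2 - \<beta> * Re z * \<bar>u\<bar>"
  proof (cases "u \<ge> 0")
    case True
    have "exp (\<beta> * u) \<ge> 1 + \<beta> * u + (\<beta> * u)\<^sup>2 / 2"
      by (rule exp_lower_Taylor_quadratic) (use True assms in auto)
    moreover have "\<beta> * u \<ge> 0" using True assms by simp
    moreover have "(\<beta> * u - 2 * Re z)\<^sup>2 \<ge> 0" by simp
    ultimately have "2 * (\<beta> * u * Re z) - exp (\<beta> * u) \<le> 2 * (Re z)\<^sup>2"
      by (simp add: power2_eq_square algebra_simps)
    thus ?thesis using True by (simp add: algebra_simps)
  next
    case False
    have "- exp (\<beta> * u) \<le> 2 * (Re z)\<^sup>2" by (rule order_trans[of _ 0]) auto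
    thus ?thesis using False by (simp add: algebra_simps)
  qed
  thus ?thesis by (simp add: norm_scale_kernel exp_add[symmetric])
qed

text \<open>The triangle inequality moves \<open>t\<close> into the constant. The majorant in
  \<open>j\<close> alone is uniform for bounded \<open>t\<close>, as the Weierstrass tests
  require.\<close>

lemma norm_scale_kernel_shift_le:
  assumes "\<beta> > 0" "Re z > 0" "\<bar>t\<bar> \<le> T"
  shows "norm (scale_kernel \<beta> z (of_int j + t))
           \<le> exp (2 * (Re z)\<^sup>2 + \<beta> * Re z * T) * exp (- (\<beta> * Re z) * \<bar>of_int j\<bar>)"
proof -
  have "\<beta> * Re z * \<bar>of_int j\<bar> \<le> \<beta> * Re z * (T + \<bar>of_int j + t\<bar>)"
    using assms by (intro mult_left_mono) auto
  hence "exp (2 * (Re z)\<^sup>2) * exp (- (\<beta> * Re z) * \<bar>of_int j + t\<bar>)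
          \<le> exp (2 * (Re z)\<^sup>2 + \<beta> * Re z * T) * exp (- (\<beta> * Re z) * \<bar>of_int j\<bar>)"
    by (simp add: exp_add[symmetric] algebra_simps)
  with norm_scale_kernel_le[OF assms(1,2), of "of_int j + t"] show ?thesis by (rule order_trans)
qed

lemma scale_bound_summable:
  assumes "\<beta> > 0" "Re z > 0"
  shows "(\<lambda>j::int. C * exp (- (\<beta> * Re z) * \<bar>of_int j\<bar>)) summable_on UNIV"
  by (intro summable_on_cmult_right exp_abs_summable_on_int) (use assms in auto)

lemma scale_kernel_summable:
  assumes "\<beta> > 0" "Re z > 0"
  shows "(\<lambda>j::int. scale_kernel \<beta> z (of_int j + t)) summable_on UNIV"
  by (rule summable_on_comparison_complex[OF scale_bound_summable[OF assms] norm_scale_kernel_shift_le[OF assms order_refl]])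

lemma scale_kernel_abs_summable:
  assumes "\<beta> > 0" "Re z > 0"
  shows "(\<lambda>j::int. norm (scale_kernel \<beta> z (of_int j + t))) summable_on UNIV"
  using scale_kernel_summable[OF assms] by (simp add: summable_on_iff_abs_summable_on_complex)

lemma infsum_shift_int:
  fixes f :: "int \<Rightarrow> 'a :: {comm_monoid_add,t2_space}"
  shows "(\<Sum>\<^sub>\<infinity>j. f (j + n)) = (\<Sum>\<^sub>\<infinity>j. f j)"
  by (rule infsum_reindex_bij_betw) (rule bij_plus_right)

lemma scale_sum_add_of_int: "scale_sum \<beta> z (t + of_int n) = scale_sum \<beta> z t"
  unfolding scale_sum_def
  using infsum_shift_int[of "\<lambda>j. scale_kernel \<beta> z (of_int j + t)" n] by (simp add: add_ac)

text \<open>Shifting \<open>j\<close> replaces \<open>t\<close> by its fractional part, so the bound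
  for \<open>\<bar>t\<bar> \<le> 1\<close> serves every \<open>t\<close>.\<close>

lemma infsum_norm_scale_kernel_bounded:
  assumes "\<beta> > 0" "Re z > 0"
  obtains C where "\<And>t. (\<Sum>\<^sub>\<infinity>j::int. norm (scale_kernel \<beta> z (of_int j + t))) \<le> C"
proof
  fix t
  let ?C = "exp (2 * (Re z)\<^sup>2 + \<beta> * Re z * 1)"
  have "(\<Sum>\<^sub>\<infinity>j::int. norm (scale_kernel \<beta> z (of_int j + t)))
        = (\<Sum>\<^sub>\<infinity>j::int. norm (scale_kernel \<beta> z (of_int j + frac t)))"
    using infsum_shift_int[of "\<lambda>j. norm (scale_kernel \<beta> z (of_int j + frac t))" "\<lfloor>t\<rfloor>"]
    by (simp add: frac_def add_ac)
  also have "\<dots> \<le> (\<Sum>\<^sub>\<infinity>j::int. ?C * exp (- (\<beta> * Re z) * \<bar>of_int j\<bar>))"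
    using frac_ge_0[of t] frac_lt_1[of t]
    by (intro infsum_mono scale_kernel_abs_summable scale_bound_summable norm_scale_kernel_shift_le assms) linarith
  finally show "(\<Sum>\<^sub>\<infinity>j::int. norm (scale_kernel \<beta> z (of_int j + t)))
                  \<le> (\<Sum>\<^sub>\<infinity>j::int. ?C * exp (- (\<beta> * Re z) * \<bar>of_int j\<bar>))" .
qed

lemma scale_kernel_has_vector_derivative:
  "(scale_kernel \<beta> z has_vector_derivative of_real \<beta> * (z * scale_kernel \<beta> z u - scale_kernel \<beta> (z + 1) u)) (at u)"
proof -
  define g where "g w = exp (of_real \<beta> * w * z - exp (of_real \<beta> * w))" for w :: complex
  have "(g has_field_derivative (of_real \<beta> * z - of_real \<beta> * exp (of_real \<beta> * of_real u)) * g (of_real u)) (at (of_real u))"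
    unfolding g_def by (auto intro!: derivative_eq_intros simp: algebra_simps)
  hence "((\<lambda>u. g (of_real u)) has_vector_derivative
           ((of_real \<beta> * z - of_real \<beta> * exp (of_real \<beta> * of_real u)) * g (of_real u))) (at u)"
    by (rule has_vector_derivative_real_field)
  moreover have "(\<lambda>u. g (of_real u)) = scale_kernel \<beta> z"
    by (simp add: g_def scale_kernel_def exp_of_real[symmetric] fun_eq_iff)
  moreover have "scale_kernel \<beta> (z + 1) u = exp (of_real \<beta> * of_real u) * scale_kernel \<beta> z u"
    using scale_kernel_mult_exp[of \<beta> u 1 z] by simp
  ultimately show ?thesis by (simp add: fun_eq_iff algebra_simps)
qed

lemma scale_kernel_shift_has_vector_derivative:
  "((\<lambda>t. scale_kernel \<beta> z (c + t)) has_vector_derivative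
     of_real \<beta> * (z * scale_kernel \<beta> z (c + t) - scale_kernel \<beta> (z + 1) (c + t))) (at t within S)"
proof -
  have "((\<lambda>t. c + t) has_vector_derivative 1) (at t)"
    by (auto intro!: derivative_eq_intros)
  from vector_diff_chain_at[OF this scale_kernel_has_vector_derivative]
  show ?thesis by (simp add: o_def has_vector_derivative_at_within)
qed

lemma continuous_on_scale_kernel [continuous_intros]:
  assumes "continuous_on S f"
  shows "continuous_on S (\<lambda>t. scale_kernel \<beta> z (f t))"
  unfolding scale_kernel_def by (intro continuous_intros assms)

text \<open>Differentiating a kernel only produces the kernels with exponents \<open>z\<close> and
  \<open>z + 1\<close>, both of positive real part, so the termwise derivatives have a summable
  majorant on \<open>{t-1<..<t+1}\<close>.\<close>

lemma scale_sum_differentiable: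
  assumes "\<beta> > 0" "Re z > 0"
  obtains D where "(scale_sum \<beta> z has_vector_derivative D) (at t)"
proof -
  define M where "M = (\<lambda>w::complex. \<lambda>j::int. exp (2 * (Re w)\<^sup>2 + \<beta> * Re w * (\<bar>t\<bar> + 1)) * exp (- (\<beta> * Re w) * \<bar>of_int j\<bar>))"
  have M: "norm (scale_kernel \<beta> w (of_int j + u)) \<le> M w j" if "u \<in> {t-1<..<t+1}" "Re w > 0" for u w j
    unfolding M_def by (rule norm_scale_kernel_shift_le) (use assms that in auto)
  have "(scale_sum \<beta> z has_vector_derivative
     (\<Sum>\<^sub>\<infinity>j::int. of_real \<beta> * (z * scale_kernel \<beta> z (of_int j + t) - scale_kernel \<beta> (z + 1) (of_int j + t)))) (at t)"
    unfolding scale_sum_def[abs_def]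
  proof (rule has_vector_derivative_infsum_int[where S = "{t-1<..<t+1}"
            and M = "\<lambda>j. \<beta> * (norm z * M z j + M (z + 1) j)"])
    fix k u assume u: "u \<in> {t-1<..<t+1}"
    have "norm (z * scale_kernel \<beta> z (of_int k + u) - scale_kernel \<beta> (z + 1) (of_int k + u))
            \<le> norm z * norm (scale_kernel \<beta> z (of_int k + u)) + norm (scale_kernel \<beta> (z + 1) (of_int k + u))"
      using norm_triangle_ineq4 by (metis norm_mult)
    also have "\<dots> \<le> norm z * M z k + M (z + 1) k"
      using assms by (intro add_mono mult_left_mono M u) auto
    finally show "norm (of_real \<beta> * (z * scale_kernel \<beta> z (of_int k + u) - scale_kernel \<beta> (z + 1) (of_int k + u)))
           \<le> \<beta> * (norm z * M z k + M (z + 1) k)"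
      using assms by (simp add: norm_mult)
  next
    show "(\<lambda>j. \<beta> * (norm z * M z j + M (z + 1) j)) summable_on UNIV"
      unfolding M_def by (intro summable_on_cmult_right summable_on_add scale_bound_summable) (use assms in auto)
  qed (use assms in \<open>auto intro: scale_kernel_shift_has_vector_derivative scale_kernel_summable\<close>)
  thus ?thesis by (rule that)
qed

section \<open>Fourier coefficients of the periodization\<close>

text \<open>Triangle inequality in Euler's integral: for \<open>t > 0\<close> the norm of
  \<open>t powr (z - 1)\<close> is \<open>t powr (Re z - 1)\<close>.\<close>

lemma norm_Gamma_le:
  assumes "Re z > 0"
  shows "norm (Gamma z) \<le> Gamma (Re z)"
proof -
  let ?f = "\<lambda>t. complex_of_real t powr (z - 1) / of_real (exp t)"
  let ?g = "\<lambda>t. t powr (Re z - 1) / exp t"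
  have f: "(?f has_integral Gamma z) {0..}" and g: "(?g has_integral Gamma (Re z)) {0..}"
    using Gamma_integral_complex[OF assms] Gamma_integral_real[OF assms] by auto
  have "norm (integral {0..} ?f) \<le> integral {0..} ?g"
    using f g by (intro Henstock_Kurzweil_Integration.integral_norm_bound_integral)
      (auto simp: norm_divide norm_powr_real_powr has_integral_integrable)
  with f g show ?thesis by (simp add: integral_unique)
qed

text \<open>Unfolding: the integrals over \<open>{0..1}\<close> of the shifted kernels are
  consecutive pieces of one integral over the real line, which the substitution
  \<open>x = exp (\<beta> * u)\<close> turns into Euler's integral; the Jacobian accounts for the
  division by \<open>\<beta>\<close>.\<close>

lemma scale_sum_integral:
  assumes "\<beta> > 0" "Re z > 0"
  shows "integral {0..1} (\<lambda>t. scale_sum \<beta> z (t0 + t)) = Gamma z / of_real \<beta>"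
proof -
  define f where "f x = exp (of_real (ln x) * (z - 1) - of_real x)" for x :: real
  define a where "a j = exp (\<beta> * (of_int j + t0))" for j :: int
  define I where "I j = {a j<..a (j + 1)}" for j
  define J where "J j = integral {0..1} (\<lambda>t. scale_kernel \<beta> z (of_int j + (t0 + t)))" for j :: int

  have f_eq: "complex_of_real x powr (z - 1) / of_real (exp x) = f x" if "x \<in> {0<..}" for x
    using that by (auto simp: f_def powr_def Ln_of_real exp_diff exp_of_real mult.commute)
  have "(\<lambda>x. complex_of_real x powr (z - 1) / of_real (exp x)) absolutely_integrable_on {0<..}"
    by (rule absolutely_integrable_Gamma_integral') fact
  moreover have "(\<lambda>x. complex_of_real x powr (z - 1) / of_real (exp x)) absolutely_integrable_on {0<..}
                   \<longleftrightarrow> f absolutely_integrable_on {0<..}"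
    by (rule set_integrable_cong[OF refl refl f_eq])
  ultimately have f_int: "f absolutely_integrable_on {0<..}" by blast
  have "((\<lambda>x. complex_of_real x powr (z - 1) / of_real (exp x)) has_integral Gamma z) {0<..}"
    by (rule Gamma_integral_complex') fact
  hence Gamma: "integral {0<..} f = Gamma z"
    by (intro integral_unique) (rule has_integral_eq[OF f_eq])
  \<comment> \<open>Describing \<open>I j\<close> as a level set of a ceiling shows at once that
    these half-open intervals are disjoint and cover the positive axis.\<close>
  have in_I: "x \<in> I j \<longleftrightarrow> x > 0 \<and> \<lceil>ln x / \<beta> - t0\<rceil> = j + 1" for x j
  proof (cases "x > 0")
    case True
    have "x \<in> I j \<longleftrightarrow> \<beta> * (of_int j + t0) < ln x \<and> ln x \<le> \<beta> * (of_int (j + 1) + t0)"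
    proof -
      have "exp (ln x) \<in> I j \<longleftrightarrow> \<beta> * (of_int j + t0) < ln x \<and> ln x \<le> \<beta> * (of_int (j + 1) + t0)"
        by (simp add: I_def a_def del: exp_ln)
      thus ?thesis using True by simp
    qed
    also have "\<dots> \<longleftrightarrow> \<lceil>ln x / \<beta> - t0\<rceil> = j + 1"
      using assms(1) by (auto simp: ceiling_eq_iff field_simps)
    finally show ?thesis using True by simp
  next
    case False
    have "0 < a j" by (simp add: a_def)
    with False show ?thesis by (auto simp: I_def)
  qed
  have UN: "(\<Union>n. I (int_decode n)) = {0<..}"
  proof (intro equalityI subsetI)
    fix x :: real assume "x \<in> {0<..}"
    hence "x \<in> I (int_decode (int_encode (\<lceil>ln x / \<beta> - t0\<rceil> - 1)))"
      by (simp add: in_I)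
    thus "x \<in> (\<Union>n. I (int_decode n))" by blast
  qed (auto simp: in_I)
  have piece: "(LINT x:I j|lebesgue. f x) = of_real \<beta> * J j" for j
  proof -
    have pos: "0 < a j" by (simp add: a_def)
    have le: "a j \<le> a (j + 1)" using assms(1) by (simp add: a_def)
    have contf: "continuous_on {a j..a (j + 1)} f"
      unfolding f_def using pos by (intro continuous_intros) auto
    define g where "g t = exp (\<beta> * (of_int j + (t0 + t)))" for t
    have g01: "g 0 = a j" "g 1 = a (j + 1)" by (simp_all add: g_def a_def algebra_simps)
    have g': "(g has_field_derivative \<beta> * g t) (at t within {0..1})" for t
      unfolding g_def by (auto intro!: derivative_eq_intros)
    have "((\<lambda>t. (\<beta> * g t) *\<^sub>R f (g t)) has_integral integral {g 0..g 1} f) {0..1}"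
    proof (rule has_integral_substitution[where c = "a j" and d = "a (j + 1)"])
      show "g ` {0..1} \<subseteq> {a j..a (j + 1)}"
        using assms(1) by (auto simp: g_def a_def)
    qed (use le g01 contf g' in auto)
    moreover have "(\<beta> * g t) *\<^sub>R f (g t) = of_real \<beta> * scale_kernel \<beta> z (of_int j + (t0 + t))" for t
    proof -
      have "of_real (g t) * f (g t) = scale_kernel \<beta> z (of_int j + (t0 + t))"
        by (simp add: f_def g_def scale_kernel_def exp_of_real[symmetric] exp_add[symmetric] algebra_simps)
      thus ?thesis by (simp add: scaleR_conv_of_real mult.assoc)
    qed
    ultimately have "((\<lambda>t. of_real \<beta> * scale_kernel \<beta> z (of_int j + (t0 + t))) has_integral
                        integral {a j..a (j + 1)} f) {0..1}"
      by (simp add: g01)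
    from integral_unique[OF this] have "of_real \<beta> * J j = integral {a j..a (j + 1)} f"
      by (simp add: J_def)
    \<comment> \<open>\<open>I j\<close> lacks only the left end point of the closed
      interval.\<close>
    also have "\<dots> = integral (I j) f"
      unfolding I_def by (rule integral_spike_set) (auto intro: negligible_subset[of "{a j}"])
    also have "\<dots> = (LINT x:I j|lebesgue. f x)"
      by (rule set_lebesgue_integral_eq_integral(2)[symmetric])
         (use UN in \<open>auto intro!: set_integrable_subset[OF f_int] simp: I_def a_def intro: less_trans[OF exp_gt_zero]\<close>)
    finally show ?thesis by simp
  qed
  have "Gamma z = (LINT x:(\<Union>n. I (int_decode n))|lebesgue. f x)"
    unfolding UN using set_lebesgue_integral_eq_integral(2)[OF f_int] Gamma by simp
  also have "\<dots> = (\<Sum>n. (LINT x:I (int_decode n)|lebesgue. f x))"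
  proof (rule lebesgue_integral_countable_add)
    show "I (int_decode i) \<inter> I (int_decode j) = {}" if "i \<noteq> j" for i j
      using that by (auto simp: in_I int_decode_eq)
  qed (use f_int UN in \<open>auto simp: I_def\<close>)
  also have "\<dots> = (\<Sum>n. of_real \<beta> * J (int_decode n))" by (simp add: piece)
  finally have G: "Gamma z = (\<Sum>n. of_real \<beta> * J (int_decode n))" .

  \<comment> \<open>\<open>T\<close> bounds \<open>\<bar>t0 + t\<bar>\<close> on
    \<open>{0..1}\<close>, so the series converges uniformly there and may be integrated term by
    term.\<close>
  define T where "T = \<bar>t0\<bar> + 1"
  have unif: "uniform_limit {0..1} (\<lambda>X t. \<Sum>j\<in>X. scale_kernel \<beta> z (of_int j + (t0 + t)))
          (\<lambda>t. scale_sum \<beta> z (t0 + t)) (finite_subsets_at_top UNIV)"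
    unfolding scale_sum_def
  proof (rule Weierstrass_m_test_general)
    show "norm (scale_kernel \<beta> z (of_int j + (t0 + t)))
           \<le> exp (2 * (Re z)\<^sup>2 + \<beta> * Re z * T) * exp (- (\<beta> * Re z) * \<bar>of_int j\<bar>)"
      if "t \<in> {0..1}" for j t
      by (rule norm_scale_kernel_shift_le) (use assms that in \<open>auto simp: T_def\<close>)
  qed (rule scale_bound_summable[OF assms])
  have cont: "continuous_on {0..1} (\<lambda>t. \<Sum>j\<in>X. scale_kernel \<beta> z (of_int j + (t0 + t)))" for X
    by (intro continuous_intros)
  obtain P Q where PQ:
    "\<And>X. ((\<lambda>t. \<Sum>j\<in>X. scale_kernel \<beta> z (of_int j + (t0 + t))) has_integral P X) {0..1}"
    "((\<lambda>t. scale_sum \<beta> z (t0 + t)) has_integral Q) {0..1}"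
    "(P \<longlongrightarrow> Q) (finite_subsets_at_top UNIV)"
    by (rule uniform_limit_integral[OF unif cont finite_subsets_at_top_neq_bot]) (rule that)
  have P: "P X = sum J X" if "finite X" for X
    using integral_unique[OF PQ(1)[of X]] that unfolding J_def
    by (subst (asm) Henstock_Kurzweil_Integration.integral_sum) (auto intro!: integrable_continuous_real continuous_intros)
  have "eventually (\<lambda>X. P X = sum J X) (finite_subsets_at_top UNIV)"
    using eventually_finite_subsets_at_top_weakI[of UNIV "\<lambda>X. P X = sum J X"] P by blast
  with PQ(3) have "(J has_sum Q) UNIV"
    unfolding has_sum_def by (rule Lim_transform_eventually)
  hence "((\<lambda>n. J (int_decode n)) has_sum Q) UNIV"
    using has_sum_reindex_bij_betw[OF bij_int_decode, of J] by simp
  hence "(\<lambda>n. of_real \<beta> * J (int_decode n)) sums (of_real \<beta> * Q)"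
    by (intro sums_mult has_sum_imp_sums)
  with G have "Gamma z = of_real \<beta> * Q" by (simp add: sums_iff)
  with PQ(2) assms show ?thesis by (simp add: integral_unique)
qed

section \<open>Rapid decay of Gamma on vertical lines, and the Fourier expansion\<close>

definition vertical_shift :: "real \<Rightarrow> complex \<Rightarrow> int \<Rightarrow> complex" where
  "vertical_shift \<beta> z k = z - 2 * of_real pi * \<i> * of_int k / of_real \<beta>"

lemma Re_vertical_shift [simp]: "Re (vertical_shift \<beta> z k) = Re z"
  by (simp add: vertical_shift_def complex_is_Real_iff)

lemma Im_vertical_shift: "Im (vertical_shift \<beta> z k) = Im z - 2 * pi * of_int k / \<beta>"
  by (simp add: vertical_shift_def)

text \<open>\<open>Gamma w = Gamma (w + r) / pochhammer w r\<close>: the numerator has norm at most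
  \<open>Gamma (Re z + r)\<close>, and each of the \<open>r\<close> factors of the denominator has
  norm at least a fixed multiple of \<open>1 + \<bar>k\<bar>\<close>.\<close>

lemma norm_Gamma_vertical_shift_le:
  assumes "\<beta> > 0" "Re z > 0"
  obtains C where "\<And>k. norm (Gamma (vertical_shift \<beta> z k)) \<le> C / (1 + \<bar>of_int k\<bar>) ^ r"
proof -
  \<comment> \<open>Solving \<open>Im ?w = Im z - 2 * pi * k / \<beta>\<close> for \<open>k\<close>
    gives the factor \<open>\<beta> / (2 * pi)\<close>; the constants
    \<open>\<bar>Im z\<bar>\<close> and 1 are absorbed by means of
    \<open>Re z \<le> norm (?w + of_nat i)\<close>.\<close>
  define K where "K = \<beta> / (2 * pi) * (\<bar>Im z\<bar> / Re z + 1) + 1 / Re z"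
  show ?thesis
  proof
    fix k :: int
    let ?w = "vertical_shift \<beta> z k"
    have factor: "1 + \<bar>of_int k\<bar> \<le> K * norm (?w + of_nat i)" for i
    proof -
      have re: "Re z \<le> norm (?w + of_nat i)"
        using complex_Re_le_cmod[of "?w + of_nat i"] by simp
      have im: "\<bar>Im ?w\<bar> \<le> norm (?w + of_nat i)"
        using abs_Im_le_cmod[of "?w + of_nat i"] by simp
      have "of_int k = \<beta> / (2 * pi) * (Im z - Im ?w)"
        using assms by (simp add: Im_vertical_shift field_simps)
      hence "\<bar>of_int k\<bar> = \<beta> / (2 * pi) * \<bar>Im z - Im ?w\<bar>"
        using assms by (simp add: abs_mult)
      also have "\<dots> \<le> \<beta> / (2 * pi) * (\<bar>Im z\<bar> / Re z * norm (?w + of_nat i) + norm (?w + of_nat i))"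
      proof (intro mult_left_mono)
        have "\<bar>Im z\<bar> / Re z * Re z \<le> \<bar>Im z\<bar> / Re z * norm (?w + of_nat i)"
          using assms re by (intro mult_left_mono) auto
        thus "\<bar>Im z - Im ?w\<bar> \<le> \<bar>Im z\<bar> / Re z * norm (?w + of_nat i) + norm (?w + of_nat i)"
          using im assms(2) by simp
      qed (use assms in auto)
      moreover have "1 \<le> 1 / Re z * norm (?w + of_nat i)"
        using re assms by (simp add: field_simps)
      ultimately show ?thesis by (simp add: K_def algebra_simps)
    qed
    have "(1 + \<bar>of_int k\<bar>) ^ r \<le> K ^ r * norm (pochhammer ?w r)"
    proof (induction r)
      case (Suc r)
      have "(1 + \<bar>of_int k\<bar>) ^ Suc r \<le> (K ^ r * norm (pochhammer ?w r)) * (K * norm (?w + of_nat r))"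
        unfolding power_Suc2 by (intro mult_mono Suc factor) (auto intro: order_trans[OF _ Suc])
      thus ?case by (simp add: pochhammer_Suc norm_mult mult_ac)
    qed simp
    hence "(1 + \<bar>of_int k\<bar>) ^ r * norm (Gamma ?w) \<le> K ^ r * norm (pochhammer ?w r) * norm (Gamma ?w)"
      by (rule mult_right_mono) simp
    also have "\<dots> = K ^ r * norm (Gamma (?w + of_nat r))"
    proof -
      have "?w \<notin> \<int>\<^sub>\<le>\<^sub>0"
        using assms by (auto elim!: nonpos_Ints_cases simp: complex_eq_iff)
      thus ?thesis using Gamma_eq_zero_iff[of ?w] by (simp add: pochhammer_Gamma norm_divide)
    qed
    also have "\<dots> \<le> K ^ r * Gamma (Re z + real r)"
      using norm_Gamma_le[of "?w + of_nat r"] assms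
      by (intro mult_left_mono) (auto simp: K_def)
    finally show "norm (Gamma ?w) \<le> K ^ r * Gamma (Re z + real r) / (1 + \<bar>of_int k\<bar>) ^ r"
      by (simp add: field_simps)
  qed
qed

lemma inverse_square_summable_on_int:
  "(\<lambda>k::int. C / (1 + \<bar>of_int k\<bar>) ^ 2 :: real) summable_on UNIV"
proof -
  have "summable (\<lambda>n. inverse (real (Suc n) ^ 2))"
    by (subst summable_Suc_iff) (rule inverse_power_summable, simp)
  hence "summable (\<lambda>n. 1 / (1 + real n) ^ 2)" by (simp add: divide_inverse)
  hence "(\<lambda>k::int. 1 / (1 + \<bar>of_int k\<bar>) ^ 2 :: real) summable_on UNIV"
    by (intro summable_on_int_split) auto
  from summable_on_cmult_right[OF this, of C] show ?thesis by simp
qed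

text \<open>Decay of order \<open>r + 2\<close> leaves the summable majorant
  \<open>C / (1 + \<bar>k\<bar>) ^ 2\<close>.\<close>

lemma Gamma_vertical_shift_summable:
  assumes "\<beta> > 0" "Re z > 0"
  shows "(\<lambda>k. (1 + \<bar>of_int k\<bar>) ^ r * norm (Gamma (vertical_shift \<beta> z k))) summable_on UNIV"
proof -
  have cancel: "x ^ r * (C / x ^ (r + 2)) = C / x ^ 2" if "x > 0" for x C :: real
    using that by (simp add: power_add power2_eq_square)
  obtain C where C: "\<And>k. norm (Gamma (vertical_shift \<beta> z k)) \<le> C / (1 + \<bar>of_int k\<bar>) ^ (r + 2)"
    using norm_Gamma_vertical_shift_le[OF assms] by blast
  show ?thesis
  proof (rule summable_on_comparison_test[OF inverse_square_summable_on_int[of C]])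
    fix k :: int
    have "(1 + \<bar>of_int k\<bar>) ^ r * norm (Gamma (vertical_shift \<beta> z k))
           \<le> (1 + \<bar>of_int k\<bar>) ^ r * (C / (1 + \<bar>of_int k\<bar>) ^ (r + 2))"
      by (intro mult_left_mono C) auto
    also have "(1 + \<bar>of_int k\<bar>) ^ r * (C / (1 + \<bar>of_int k\<bar>) ^ (r + 2)) = C / (1 + \<bar>of_int k\<bar>) ^ 2"
      by (rule cancel) auto
    finally show "(1 + \<bar>of_int k\<bar>) ^ r * norm (Gamma (vertical_shift \<beta> z k)) \<le> C / (1 + \<bar>of_int k\<bar>) ^ 2" .
  qed auto
qed

text \<open>Having period 1, the character may be evaluated at \<open>j + t\<close> inside the sum,
  where it is a purely imaginary power of \<open>exp (\<beta> * (j + t))\<close> and so only changes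
  the exponent of the kernel.\<close>

lemma scale_sum_mult_character:
  assumes "\<beta> > 0" "Re z > 0"
  shows "scale_sum \<beta> z t * character (- k) t = scale_sum \<beta> (vertical_shift \<beta> z k) t"
proof -
  have shift: "scale_kernel \<beta> z (of_int j + t) * character (- k) t = scale_kernel \<beta> (vertical_shift \<beta> z k) (of_int j + t)" for j
  proof -
    have "character (- k) t = character (- k) (of_int j + t)"
      by (simp add: character_arg_add)
    also have "\<dots> = exp (of_real (\<beta> * (of_int j + t)) * (- (2 * of_real pi * \<i> * of_int k / of_real \<beta>)))"
      using assms by (simp add: character_def mult_ac)
    finally show ?thesis
      using scale_kernel_mult_exp[of \<beta> "of_int j + t" "- (2 * of_real pi * \<i> * of_int k / of_real \<beta>)" z]
      by (simp add: vertical_shift_def mult.commute)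
  qed
  have "scale_sum \<beta> z t * character (- k) t = (\<Sum>\<^sub>\<infinity>j::int. scale_kernel \<beta> z (of_int j + t) * character (- k) t)"
    unfolding scale_sum_def by (rule infsum_cmult_left[symmetric]) (use assms in \<open>simp add: scale_kernel_summable\<close>)
  also have "\<dots> = scale_sum \<beta> (vertical_shift \<beta> z k) t"
    by (simp add: shift scale_sum_def)
  finally show ?thesis .
qed

text \<open>The convergence result concerns the point 0, so it is applied to the translate
  \<open>h u = scale_sum \<beta> z (t + u)\<close>, whose coefficients carry the extra factor
  \<open>character k t\<close>.\<close>

lemma scale_sum_fourier_expansion:
  assumes "\<beta> > 0" "Re z > 0"
  shows "scale_sum \<beta> z t = (\<Sum>\<^sub>\<infinity>k. character k t * Gamma (vertical_shift \<beta> z k)) / of_real \<beta>"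
proof -
  define h where "h u = scale_sum \<beta> z (t + u)" for u
  have deriv: "\<exists>D. (h has_vector_derivative D) (at u)" for u
  proof -
    obtain D where D: "(scale_sum \<beta> z has_vector_derivative D) (at (t + u))"
      using scale_sum_differentiable[OF assms] .
    have "((\<lambda>u. t + u) has_vector_derivative 1) (at u)"
      by (auto intro!: derivative_eq_intros)
    from vector_diff_chain_at[OF this D] show ?thesis by (auto simp: h_def[abs_def] o_def)
  qed
  have coeff: "fourier_coeff h k = character k t * Gamma (vertical_shift \<beta> z k) / of_real \<beta>" for k
  proof -
    have "h u * character (- k) u = character k t * scale_sum \<beta> (vertical_shift \<beta> z k) (t + u)" for u
    proof -
      have "character (- k) u = character (- k) (t + u) * character k t"
        using character_mult_cnj[of k t] by (simp add: character_arg_add character_uminus mult_ac)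
      thus ?thesis using scale_sum_mult_character[OF assms, of "t + u" k] by (simp add: h_def mult_ac)
    qed
    hence "fourier_coeff h k = character k t * integral {0..1} (\<lambda>u. scale_sum \<beta> (vertical_shift \<beta> z k) (t + u))"
      unfolding fourier_coeff_def by simp
    also have "integral {0..1} (\<lambda>u. scale_sum \<beta> (vertical_shift \<beta> z k) (t + u)) = Gamma (vertical_shift \<beta> z k) / of_real \<beta>"
      by (rule scale_sum_integral) (use assms in auto)
    finally show ?thesis by simp
  qed
  have "(\<lambda>k. character k t * Gamma (vertical_shift \<beta> z k)) summable_on UNIV"
    by (rule summable_on_comparison_complex[OF Gamma_vertical_shift_summable[OF assms, of 0]])
       (simp add: norm_mult)
  hence "((\<lambda>k. character k t * Gamma (vertical_shift \<beta> z k)) has_sum (\<Sum>\<^sub>\<infinity>k. character k t * Gamma (vertical_shift \<beta> z k))) UNIV"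
    by (rule has_sum_infsum)
  hence "(fourier_coeff h has_sum ((\<Sum>\<^sub>\<infinity>k. character k t * Gamma (vertical_shift \<beta> z k)) / of_real \<beta>)) UNIV"
    unfolding coeff[abs_def] by (rule has_sum_divide_const)
  moreover have "h 1 = h 0"
    using scale_sum_add_of_int[of \<beta> z t 1] by (simp add: h_def)
  moreover have "continuous_on {0..1} h"
    using deriv has_vector_derivative_continuous continuous_at_imp_continuous_on by blast
  ultimately have "(\<Sum>\<^sub>\<infinity>k. character k t * Gamma (vertical_shift \<beta> z k)) / of_real \<beta> = h 0"
    using deriv[of 0] deriv[of 1] fourier_series_at_0 has_vector_derivative_at_within by metis
  thus ?thesis by (simp add: h_def)
qed

section \<open>Trigonometric series and logarithmic averages\<close>

definition trig_series :: "(int \<Rightarrow> complex) \<Rightarrow> real \<Rightarrow> complex" where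
  "trig_series c t = (\<Sum>\<^sub>\<infinity>k. character k t * c k)"

lemma trig_series_summable:
  assumes "(\<lambda>k. norm (c k)) summable_on UNIV"
  shows "(\<lambda>k. character k t * c k) summable_on UNIV"
  by (rule summable_on_comparison_complex[OF assms]) (simp add: norm_mult)

lemma norm_trig_series_le:
  assumes "(\<lambda>k. norm (c k)) summable_on UNIV"
  shows "norm (trig_series c t) \<le> (\<Sum>\<^sub>\<infinity>k. norm (c k))"
  unfolding trig_series_def
  using norm_infsum_bound[of "\<lambda>k. character k t * c k" UNIV] assms by (simp add: norm_mult)

lemma trig_series_add_1: "trig_series c (t + 1) = trig_series c t"
  by (simp add: trig_series_def character_arg_add)

lemma trig_series_has_vector_derivative:
  assumes "(\<lambda>k. (1 + \<bar>of_int k\<bar>) * norm (c k)) summable_on UNIV"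
  shows "(trig_series c has_vector_derivative trig_series (\<lambda>k. 2 * of_real pi * \<i> * of_int k * c k) t) (at t)"
proof -
  have "(\<lambda>k. norm (c k)) summable_on UNIV"
    by (rule summable_on_comparison_test[OF assms]) (auto simp: mult_le_cancel_right1)
  hence c: "(\<lambda>k. character k u * c k) summable_on UNIV" for u
    by (rule trig_series_summable)
  show ?thesis
    unfolding trig_series_def[abs_def]
  proof (rule has_vector_derivative_infsum_int[where S = UNIV and M = "\<lambda>k. 2 * pi * ((1 + \<bar>of_int k\<bar>) * norm (c k))"])
    show "((\<lambda>t. character k t * c k) has_vector_derivative character k u * (2 * of_real pi * \<i> * of_int k * c k)) (at u)" for k u
      using has_vector_derivative_mult_left[OF character_has_vector_derivative[of k u UNIV], of "c k"]
      by (simp add: mult_ac)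
    show "norm (character k u * (2 * of_real pi * \<i> * of_int k * c k)) \<le> 2 * pi * ((1 + \<bar>of_int k\<bar>) * norm (c k))" for k u
      by (simp add: norm_mult mult_right_mono)
  qed (use assms c in \<open>auto intro: summable_on_cmult_right\<close>)
qed

text \<open>The \<open>n\<close>-th derivative has coefficients
  \<open>(2 * pi * \<i> * k) ^ n * c k\<close>; differentiating it once more uses the weight of
  order \<open>n + 1\<close>.\<close>

lemma trig_series_smooth:
  assumes "\<And>r. (\<lambda>k. (1 + \<bar>of_int k\<bar>) ^ r * norm (c k)) summable_on UNIV"
  obtains D where "D 0 = trig_series c"
    and "\<And>n t. (D n has_vector_derivative D (Suc n) t) (at t)"
proof
  define D where "D n = trig_series (\<lambda>k. (2 * of_real pi * \<i> * of_int k) ^ n * c k)" for n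
  show "D 0 = trig_series c" by (simp add: D_def)
  fix n t
  have "(\<lambda>k. (1 + \<bar>of_int k\<bar>) * norm ((2 * of_real pi * \<i> * of_int k) ^ n * c k)) summable_on UNIV"
  proof (rule summable_on_comparison_test)
    show "(\<lambda>k. (2 * pi) ^ n * ((1 + \<bar>of_int k\<bar>) ^ Suc n * norm (c k))) summable_on UNIV"
      by (intro summable_on_cmult_right assms)
    fix k :: int
    have "\<bar>real_of_int k\<bar> ^ n \<le> (1 + \<bar>of_int k\<bar>) ^ n" by (intro power_mono) auto
    thus "(1 + \<bar>of_int k\<bar>) * norm ((2 * of_real pi * \<i> * of_int k) ^ n * c k)
            \<le> (2 * pi) ^ n * ((1 + \<bar>of_int k\<bar>) ^ Suc n * norm (c k))"
      by (simp add: norm_mult norm_power power_mult_distrib mult_ac mult_left_mono)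
  qed simp
  from trig_series_has_vector_derivative[OF this, of t]
  show "(D n has_vector_derivative D (Suc n) t) (at t)" by (simp add: D_def mult_ac)
qed

text \<open>Termwise integration. The constant term integrates to the linear function
  \<open>t * c 0\<close>, the only non-periodic contribution, which causes the increment over a
  period.\<close>

lemma trig_series_antiderivative:
  assumes c: "(\<lambda>k. norm (c k)) summable_on UNIV"
  obtains P where "\<And>t. (P has_vector_derivative trig_series c t) (at t)"
    and "\<And>t. P (t + 1) = P t + c 0"
proof
  define f where "f k t = (if k = 0 then of_real t * c 0 else character k t * (c k / (2 * of_real pi * \<i> * of_int k)))" for k t
  define P where "P t = (\<Sum>\<^sub>\<infinity>k. f k t)" for t
  have f: "(\<lambda>k. f k t) summable_on UNIV" for t
  proof (rule summable_on_comparison_complex)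
    show "(\<lambda>k. (1 + \<bar>t\<bar>) * norm (c k)) summable_on UNIV"
      by (intro summable_on_cmult_right c)
    show "norm (f k t) \<le> (1 + \<bar>t\<bar>) * norm (c k)" for k
    proof (cases "k = 0")
      case False
      hence "1 \<le> \<bar>real_of_int k\<bar>" by linarith
      hence "1 \<le> 2 * pi * \<bar>real_of_int k\<bar>"
        using pi_ge_two mult_mono[of 1 "2 * pi" 1 "\<bar>real_of_int k\<bar>"] by simp
      hence "norm (c k) / (2 * pi * \<bar>real_of_int k\<bar>) \<le> norm (c k) / 1"
        by (intro divide_left_mono) auto
      also have "\<dots> \<le> (1 + \<bar>t\<bar>) * norm (c k)" by (simp add: mult_le_cancel_right1)
      finally show ?thesis using False by (simp add: f_def norm_mult norm_divide)
    qed (simp add: f_def norm_mult mult_right_mono)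
  qed
  show "(P has_vector_derivative trig_series c t) (at t)" for t
    unfolding P_def[abs_def] trig_series_def
  proof (rule has_vector_derivative_infsum_int[where S = UNIV and M = "\<lambda>k. norm (c k)"])
    show "(f k has_vector_derivative character k u * c k) (at u)" for k u
    proof (cases "k = 0")
      case True
      have "((\<lambda>u. u *\<^sub>R c 0) has_vector_derivative c 0) (at u)"
        by (auto intro!: derivative_eq_intros)
      thus ?thesis using True by (simp add: f_def[abs_def] scaleR_conv_of_real)
    next
      case False
      thus ?thesis
        using has_vector_derivative_mult_left[OF character_has_vector_derivative[of k u UNIV],
                of "c k / (2 * of_real pi * \<i> * of_int k)"]
        by (simp add: f_def[abs_def])
    qed
  qed (use c f in \<open>auto simp: norm_mult\<close>)
  show "P (t + 1) = P t + c 0" for t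
  proof -
    have delta: "((\<lambda>k::int. if k = 0 then c 0 else 0) has_sum c 0) UNIV"
      by (rule has_sum_finite_neutralI[of "{0}"]) auto
    have "f k (t + 1) = f k t + (if k = 0 then c 0 else 0)" for k
      by (simp add: f_def character_arg_add ring_distribs)
    hence "P (t + 1) = (\<Sum>\<^sub>\<infinity>k. f k t + (if k = 0 then c 0 else 0))"
      by (simp add: P_def)
    also have "\<dots> = P t + c 0"
      unfolding P_def using delta f by (subst infsum_add) (auto simp: has_sum_iff)
    finally show ?thesis .
  qed
qed

section \<open>Weighted averages over the blocks between consecutive powers of the base\<close>

lemma log_ratio_bounds:
  assumes "b > 1" "m > 1"
  shows "0 \<le> log b (m / (m - 1))" "log b (m / (m - 1)) \<le> 1 / ((m - 1) * ln b)"
proof -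
  show "0 \<le> log b (m / (m - 1))"
    using assms by (subst zero_le_log_cancel_iff) (auto simp: field_simps)
  have "ln (m / (m - 1)) \<le> m / (m - 1) - 1"
    by (rule ln_le_minus_one) (use assms in auto)
  also have "\<dots> = 1 / (m - 1)" using assms by (simp add: field_simps)
  finally show "log b (m / (m - 1)) \<le> 1 / ((m - 1) * ln b)"
    using divide_right_mono[of "ln (m / (m - 1))" "1 / (m - 1)" "ln b"] assms by (simp add: log_def)
qed

text \<open>The weights \<open>log b (m / (m - 1))\<close> are the mesh widths of the partition of \<open>[p, p + 1]\<close> by the
  points \<open>log b m\<close>, so the weighted averages are Riemann sums of the trigonometric series.\<close>

lemma log_average_tendsto:
  fixes b :: nat and G :: "nat \<Rightarrow> complex"
  assumes b: "b \<ge> 2"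
    and c: "(\<lambda>k. (1 + \<bar>of_int k\<bar>) * norm (c k)) summable_on UNIV"
    and G: "\<And>m. m \<ge> 1 \<Longrightarrow> norm (G m - trig_series c (log b m)) \<le> C / m"
  shows "(\<lambda>p. \<Sum>m\<in>{b ^ p<..b ^ Suc p}. G m * of_real (log b (real m / (real m - 1)))) \<longlonglongrightarrow> c 0"
proof -
  define F where "F = trig_series c"
  have "(\<lambda>k. norm (c k)) summable_on UNIV"
    by (rule summable_on_comparison_test[OF c]) (auto simp: mult_le_cancel_right1)
  then obtain P where P: "\<And>t. (P has_vector_derivative F t) (at t)" "\<And>t. P (t + 1) = P t + c 0"
    using trig_series_antiderivative[of c] unfolding F_def by blast
  \<comment> \<open>\<open>L\<close> bounds the derivative of \<open>F\<close> and hence serves as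
    its Lipschitz constant; the weight in the hypothesis on \<open>c\<close> makes it
    finite.\<close>
  define L where "L = (\<Sum>\<^sub>\<infinity>k. norm (2 * of_real pi * \<i> * of_int k * c k))"
  have "(\<lambda>k. norm (2 * of_real pi * \<i> * of_int k * c k)) summable_on UNIV"
    by (rule summable_on_comparison_test[OF summable_on_cmult_right[OF c, of "2 * pi"]])
       (auto simp: norm_mult mult_right_mono)
  hence F'_le: "norm (trig_series (\<lambda>k. 2 * of_real pi * \<i> * of_int k * c k) t) \<le> L" for t
    unfolding L_def by (rule norm_trig_series_le)
  have Lnn: "L \<ge> 0" unfolding L_def by (rule infsum_nonneg) simp
  have onorm: "onorm (\<lambda>h. h *\<^sub>R v) \<le> L" if "norm v \<le> L" for v :: complex
    by (rule onorm_bound) (use that Lnn in \<open>auto simp: mult.commute[of L] mult_left_mono\<close>)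
  have lip: "norm (F x - F y) \<le> L * norm (x - y)" for x y
    unfolding F_def
    by (rule differentiable_bound[of UNIV _ "\<lambda>t h. h *\<^sub>R trig_series (\<lambda>k. 2 * of_real pi * \<i> * of_int k * c k) t"])
       (use trig_series_has_vector_derivative[OF c] onorm[OF F'_le] in \<open>auto simp: has_vector_derivative_def\<close>)
  have Cnn: "C \<ge> 0" using order_trans[OF norm_ge_zero G[of 1]] by simp
  define \<delta> where "\<delta> m = log b (real m / (real m - 1))" for m :: nat
  \<comment> \<open>On the block above \<open>b ^ p\<close> every mesh width is at most
    \<open>(1 / b) ^ p / ln b\<close>, which multiplies the Lipschitz constant \<open>L\<close>,
    while \<open>C / m\<close> is at most \<open>C * (1 / b) ^ p\<close>.\<close>
  define E where "E p = (1 / ln b * L + C) * (1 / b) ^ p" for p :: nat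
  have main: "norm ((\<Sum>m\<in>{b ^ p<..b ^ Suc p}. G m * of_real (\<delta> m)) - c 0) \<le> E p" for p
  proof -
    define S where "S = {b ^ p<..b ^ Suc p}"
    have bp: "real b ^ p \<ge> 1" using b by (simp add: one_le_power)
    have mS: "real m > 1" "real m - 1 \<ge> real b ^ p" "1 \<le> m" if "m \<in> S" for m
    proof -
      have "b ^ p + 1 \<le> m" using that by (simp add: S_def)
      hence "real (b ^ p + 1) \<le> real m" by (simp only: of_nat_le_iff)
      thus "real m > 1" "real m - 1 \<ge> real b ^ p" "1 \<le> m" using bp by auto
    qed
    have \<delta>: "0 \<le> \<delta> m" "\<delta> m \<le> 1 / ln b * (1 / b) ^ p" "log b m - log b (real (m - 1)) = \<delta> m" if "m \<in> S" for m
    proof -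
      show "0 \<le> \<delta> m" unfolding \<delta>_def by (rule log_ratio_bounds(1)) (use b mS[OF that] in auto)
      have "\<delta> m \<le> 1 / ((real m - 1) * ln b)"
        unfolding \<delta>_def by (rule log_ratio_bounds(2)) (use b mS[OF that] in auto)
      also have "\<dots> \<le> 1 / (real b ^ p * ln b)"
        by (intro divide_left_mono mult_right_mono mult_pos_pos mS(2)[OF that])
           (use b bp mS(1)[OF that] in \<open>simp_all\<close>)
      finally show "\<delta> m \<le> 1 / ln b * (1 / b) ^ p" by (simp add: power_one_over mult.commute)
      have "real (m - 1) = real m - 1" using mS(3)[OF that] by simp
      moreover have "ln (real m / (real m - 1)) = ln (real m) - ln (real m - 1)"
        using mS(1)[OF that] by (simp add: ln_div)
      ultimately show "log b m - log b (real (m - 1)) = \<delta> m"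
        by (simp add: \<delta>_def log_def diff_divide_distrib)
    qed
    have tele: "(\<Sum>m\<in>S. f m - f (m - 1)) = f (b ^ Suc p) - f (b ^ p)" for f :: "nat \<Rightarrow> 'b :: ab_group_add"
      unfolding S_def atLeastSucAtMost_greaterThanAtMost[symmetric]
      by (rule sum_telescope'') (use b in \<open>simp add: power_increasing\<close>)
    \<comment> \<open>Since \<open>log b (b ^ p) = p\<close>, the increments of \<open>P\<close>
      telescope to its increment over one full period.\<close>
    have "(\<Sum>m\<in>S. P (log b m) - P (log b (real (m - 1)))) = P (real p + 1) - P (real p)"
      using tele[of "\<lambda>m. P (log b (real m))"] b by (simp add: log_nat_power log_mult add.commute)
    hence c0: "(\<Sum>m\<in>S. P (log b m) - P (log b (real (m - 1)))) = c 0"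
      using P(2)[of "real p"] by simp
    have sum_\<delta>: "(\<Sum>m\<in>S. \<delta> m) = 1"
    proof -
      have "(\<Sum>m\<in>S. \<delta> m) = (\<Sum>m\<in>S. log b m - log b (real (m - 1)))"
        using \<delta>(3) by simp
      also have "\<dots> = 1"
        using tele[of "\<lambda>m. log b (real m)"] b by (simp add: log_nat_power log_mult)
      finally show ?thesis .
    qed
    have step: "norm (G m * of_real (\<delta> m) - (P (log b m) - P (log b (real (m - 1))))) \<le> E p * \<delta> m"
      if m: "m \<in> S" for m
    proof -
      let ?x = "log b (real m)" and ?y = "log b (real (m - 1))"
      have y: "?y = ?x - \<delta> m" using \<delta>(3)[OF m] by simp
      \<comment> \<open>On this subinterval \<open>F\<close> stays within
        \<open>L * \<delta> m\<close> of its value at the right end point, so linearizing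
        \<open>P\<close> there costs at most that times the width.\<close>
      have "norm (P ?x - P ?y - (?x - ?y) *\<^sub>R F ?x) \<le> norm (?x - ?y) * (L * \<delta> m)"
      proof (rule vector_differentiable_bound_linearization[where S = "{?y..?x}" and f' = F])
        show "norm (F t - F ?x) \<le> L * \<delta> m" if "t \<in> {?y..?x}" for t
          using lip[of t ?x] mult_left_mono[OF _ Lnn, of "norm (t - ?x)" "\<delta> m"] that y by auto
      qed (use P(1) \<delta>(1)[OF m] y in \<open>auto simp: closed_segment_eq_real_ivl has_vector_derivative_at_within\<close>)
      hence "norm (P ?x - P ?y - \<delta> m *\<^sub>R F ?x) \<le> norm (\<delta> m) * (L * \<delta> m)"
        by (simp only: \<delta>(3)[OF m])
      hence 1: "norm (of_real (\<delta> m) * F ?x - (P ?x - P ?y)) \<le> \<delta> m * (L * \<delta> m)"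
        using \<delta>(1)[OF m] norm_minus_commute[of "P ?x - P ?y" "\<delta> m *\<^sub>R F ?x"]
        by (simp add: scaleR_conv_of_real)
      have "norm ((G m - F ?x) * of_real (\<delta> m)) \<le> C / m * \<delta> m"
        using mult_right_mono[OF G[OF mS(3)[OF m]] \<delta>(1)[OF m]] \<delta>(1)[OF m] by (simp add: norm_mult F_def)
      also have "\<dots> \<le> C * (1 / b) ^ p * \<delta> m"
      proof (intro mult_right_mono \<delta>(1)[OF m])
        have "C / m \<le> C / real b ^ p"
          by (intro divide_left_mono mult_pos_pos Cnn) (use mS(1,2)[OF m] bp in linarith)+
        thus "C / m \<le> C * (1 / b) ^ p" by (simp add: power_one_over)
      qed
      finally have 2: "norm ((G m - F ?x) * of_real (\<delta> m)) \<le> C * (1 / b) ^ p * \<delta> m" .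
      have "\<delta> m * (L * \<delta> m) \<le> 1 / ln b * (1 / b) ^ p * (L * \<delta> m)"
        by (intro mult_right_mono \<delta>[OF m] mult_nonneg_nonneg Lnn)
      hence "norm (of_real (\<delta> m) * F ?x - (P ?x - P ?y)) + norm ((G m - F ?x) * of_real (\<delta> m)) \<le> E p * \<delta> m"
        using 1 2 by (simp add: E_def algebra_simps)
      moreover have "G m * of_real (\<delta> m) - (P ?x - P ?y)
                      = (of_real (\<delta> m) * F ?x - (P ?x - P ?y)) + (G m - F ?x) * of_real (\<delta> m)"
        by (simp add: algebra_simps)
      ultimately show ?thesis using norm_triangle_ineq order_trans by metis
    qed
    have "norm ((\<Sum>m\<in>S. G m * of_real (\<delta> m)) - c 0)
           = norm (\<Sum>m\<in>S. G m * of_real (\<delta> m) - (P (log b m) - P (log b (real (m - 1)))))"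
      by (simp only: sum_subtractf[symmetric] c0[symmetric])
    also have "\<dots> \<le> (\<Sum>m\<in>S. E p * \<delta> m)" by (intro sum_norm_le step)
    also have "\<dots> = E p" by (simp add: sum_distrib_left[symmetric] sum_\<delta>)
    finally show ?thesis by (simp add: S_def)
  qed
  have "E \<longlonglongrightarrow> (1 / ln b * L + C) * 0"
    unfolding E_def by (intro tendsto_intros LIMSEQ_realpow_zero) (use b in auto)
  hence "E \<longlonglongrightarrow> 0" by simp
  moreover have "eventually (\<lambda>p. norm ((\<Sum>m\<in>{b ^ p<..b ^ Suc p}. G m * of_real (\<delta> m)) - c 0) \<le> E p) sequentially"
    using main by simp
  ultimately have "(\<lambda>p. (\<Sum>m\<in>{b ^ p<..b ^ Suc p}. G m * of_real (\<delta> m)) - c 0) \<longlonglongrightarrow> 0"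
    by (rule Lim_null_comparison[rotated])
  thus ?thesis by (simp add: \<delta>_def Lim_null[symmetric])
qed

section \<open>Digit words\<close>

lemma radix_set_iff:
  assumes "b \<ge> 2" "0 \<in> D"
  shows "n \<in> radix_set b D \<longleftrightarrow> n mod b \<in> D \<and> n div b \<in> radix_set b D"
proof
  assume n: "n \<in> radix_set b D"
  have "n mod b \<in> D"
    using n assms(2) by (cases "n = 0") (auto simp: radix_set_def dest: spec[of _ 0])
  moreover have "n div b \<in> radix_set b D"
    unfolding radix_set_def
  proof (intro CollectI allI impI)
    fix k assume "n div b div b ^ k \<noteq> 0"
    thus "n div b div b ^ k mod b \<in> D"
      using n by (auto simp: radix_set_def div_mult2_eq[symmetric] dest: spec[of _ "Suc k"])
  qed
  ultimately show "n mod b \<in> D \<and> n div b \<in> radix_set b D" ..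
next
  assume n: "n mod b \<in> D \<and> n div b \<in> radix_set b D"
  show "n \<in> radix_set b D"
    unfolding radix_set_def
  proof (intro CollectI allI impI)
    fix k assume "n div b ^ k \<noteq> 0"
    thus "n div b ^ k mod b \<in> D"
      using n by (cases k) (auto simp: radix_set_def div_mult2_eq)
  qed
qed

lemma zero_in_radix_set: "0 \<in> radix_set b D"
  by (simp add: radix_set_def)

section \<open>Words over the digits and the integers with complementary digits\<close>

locale full_digits =
  fixes b :: nat and A :: "nat set"
  assumes b: "b \<ge> 2" and A: "A \<subseteq> {..<b}" "A \<noteq> {}" and Max_A: "Max A = b - 1"
begin

lemma finite_A [simp]: "finite A"
  using A finite_subset by blast

lemma max_digit: "b - 1 \<in> A"
  using Max_in[OF finite_A A(2)] Max_A by simp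

text \<open>As \<open>b - 1\<close> lies in \<open>A\<close>, 0 is a complementary digit; padding
  with leading zeros makes these integers correspond to words of length exactly
  \<open>l\<close>.\<close>

definition calB_below :: "nat \<Rightarrow> nat set" where
  "calB_below l = {n \<in> calB b A. n < b ^ l}"

text \<open>Taking the complement \<open>b - 1 - a\<close> is injective on digits, so the complement
  is an allowed lowest digit exactly when \<open>a\<close> lies in \<open>A\<close>.\<close>

lemma calB_append_iff:
  assumes "a < b"
  shows "b * n + (b - 1 - a) \<in> calB b A \<longleftrightarrow> a \<in> A \<and> n \<in> calB b A"
proof -
  have "0 \<in> (\<lambda>a. b - 1 - a) ` A" using max_digit by force
  from radix_set_iff[OF b this, of "b * n + (b - 1 - a)"]
  have "b * n + (b - 1 - a) \<in> calB b A \<longleftrightarrow> b - 1 - a \<in> (\<lambda>a. b - 1 - a) ` A \<and> n \<in> calB b A"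
    using b by (simp add: calB_def Max_A)
  moreover have "b - 1 - a \<in> (\<lambda>a. b - 1 - a) ` A \<longleftrightarrow> a \<in> A"
  proof
    assume "b - 1 - a \<in> (\<lambda>a. b - 1 - a) ` A"
    then obtain a' where "a' \<in> A" "b - 1 - a = b - 1 - a'" by blast
    moreover have "a' < b" using \<open>a' \<in> A\<close> A by auto
    ultimately have "a' = a" using assms by linarith
    with \<open>a' \<in> A\<close> show "a \<in> A" by simp
  qed simp
  ultimately show ?thesis by simp
qed

lemma calB_below_Suc_bij:
  "bij_betw (\<lambda>(n, a). b * n + (b - 1 - a)) (calB_below l \<times> A) (calB_below (Suc l))"
  unfolding bij_betw_def
proof
  let ?f = "\<lambda>(n, a). b * n + (b - 1 - a)"
  have digit: "a < b" if "a \<in> A" for a using that A by auto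
  show "inj_on ?f (calB_below l \<times> A)"
  proof (rule inj_onI, clarsimp)
    fix n a n' a' assume H: "a \<in> A" "a' \<in> A" "b * n + (b - Suc a) = b * n' + (b - Suc a')"
    have "(b * n + (b - Suc a)) div b = n" "(b * n' + (b - Suc a')) div b = n'"
      using b by simp_all
    with H(3) have "n = n'" by metis
    thus "n = n' \<and> a = a'" using H digit[OF H(1)] digit[OF H(2)] by auto
  qed
  show "?f ` (calB_below l \<times> A) = calB_below (Suc l)"
  proof (intro equalityI subsetI)
    fix x assume "x \<in> ?f ` (calB_below l \<times> A)"
    then obtain n a where x: "x = b * n + (b - 1 - a)" and n: "n \<in> calB b A" "n < b ^ l" and a: "a \<in> A"
      by (auto simp: calB_below_def)
    have "b * n + (b - 1 - a) < b * (n + 1)" using b by simp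
    also have "\<dots> \<le> b * b ^ l" using n(2) by (intro mult_le_mono) auto
    finally show "x \<in> calB_below (Suc l)"
      using calB_append_iff[OF digit[OF a]] n a x by (simp add: calB_below_def)
  next
    fix x assume x: "x \<in> calB_below (Suc l)"
    define a where "a = b - 1 - x mod b"
    have mod: "x mod b < b" using b by simp
    hence a: "a < b" "b - 1 - a = x mod b" using b unfolding a_def by linarith+
    have x_eq: "x = b * (x div b) + (b - 1 - a)" by (simp only: a(2) mult_div_mod_eq)
    have "a \<in> A" "x div b \<in> calB b A"
      using x calB_append_iff[OF a(1), of "x div b"] x_eq by (simp_all add: calB_below_def)
    moreover have "x div b < b ^ l"
      using x by (intro less_mult_imp_div_less) (simp add: calB_below_def mult.commute)
    ultimately have "(x div b, a) \<in> calB_below l \<times> A" by (simp add: calB_below_def)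
    thus "x \<in> ?f ` (calB_below l \<times> A)"
      using x_eq by (intro image_eqI[of _ _ "(x div b, a)"]) simp_all
  qed
qed

lemma finite_calB_below [simp]: "finite (calB_below l)"
  by (simp add: calB_below_def)

lemma calB_below_0: "calB_below 0 = {0}"
  by (auto simp: calB_below_def calB_def zero_in_radix_set)

lemma card_calB_below: "card (calB_below l) = card A ^ l"
  by (induction l)
     (simp_all add: calB_below_0 bij_betw_same_card[OF calB_below_Suc_bij, symmetric] card_cartesian_product)

lemma words_Suc_bij: "bij_betw (\<lambda>(w, a). w @ [a]) (words A l \<times> A) (words A (Suc l))"
  unfolding bij_betw_def
proof
  show "inj_on (\<lambda>(w, a). w @ [a]) (words A l \<times> A)" by (auto simp: inj_on_def)
  show "(\<lambda>(w, a). w @ [a]) ` (words A l \<times> A) = words A (Suc l)"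
  proof (intro equalityI subsetI)
    fix x assume x: "x \<in> words A (Suc l)"
    hence "x \<noteq> []" by (auto simp: words_def)
    hence "x = butlast x @ [last x]" "set (butlast x) \<subseteq> set x" "last x \<in> set x"
      by (auto dest: in_set_butlastD)
    with x show "x \<in> (\<lambda>(w, a). w @ [a]) ` (words A l \<times> A)"
      by (intro image_eqI[of _ _ "(butlast x, last x)"]) (auto simp: words_def)
  qed (auto simp: words_def)
qed

lemma digit_val_snoc: "digit_val b (w @ [a]) = digit_val b w + real a / real b ^ Suc (length w)"
  by (simp add: digit_val_def nth_append)

text \<open>A word \<open>w\<close> of length \<open>l\<close> corresponds to the \<open>n\<close> with complementary digits, for which
  \<open>1 - digit_val b w = (n + 1) / b ^ l\<close>; both sides are built up by appending a last digit.\<close>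

lemma sum_words_eq_sum_calB_below:
  fixes g :: "real \<Rightarrow> complex"
  shows "(\<Sum>w\<in>words A l. g (digit_val b w)) = (\<Sum>n\<in>calB_below l. g (1 - (real n + 1) / real b ^ l))"
proof (induction l arbitrary: g)
  case 0
  have "words A 0 = {[]}" by (auto simp: words_def)
  thus ?case by (simp add: calB_below_0 digit_val_def)
next
  case (Suc l)
  have "(\<Sum>w\<in>words A (Suc l). g (digit_val b w)) = (\<Sum>(w, a)\<in>words A l \<times> A. g (digit_val b (w @ [a])))"
    by (subst sum.reindex_bij_betw[OF words_Suc_bij, symmetric]) (simp add: case_prod_unfold)
  also have "\<dots> = (\<Sum>(w, a)\<in>words A l \<times> A. g (digit_val b w + real a / real b ^ Suc l))"
    by (intro sum.cong) (auto simp: digit_val_snoc words_def)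
  also have "\<dots> = (\<Sum>a\<in>A. \<Sum>w\<in>words A l. g (digit_val b w + real a / real b ^ Suc l))"
    by (subst sum.swap) (simp add: sum.cartesian_product)
  also have "\<dots> = (\<Sum>a\<in>A. \<Sum>n\<in>calB_below l. g (1 - (real n + 1) / real b ^ l + real a / real b ^ Suc l))"
    \<comment> \<open>The induction hypothesis is applied to \<open>g\<close> translated by the
      contribution of the last digit, which is why \<open>g\<close> is arbitrary.\<close>
    by (intro sum.cong refl Suc[of "\<lambda>x. g (x + _)"])
  also have "\<dots> = (\<Sum>(n, a)\<in>calB_below l \<times> A. g (1 - (real n + 1) / real b ^ l + real a / real b ^ Suc l))"
    by (subst sum.swap) (simp add: sum.cartesian_product)
  also have "\<dots> = (\<Sum>(n, a)\<in>calB_below l \<times> A. g (1 - (real (b * n + (b - 1 - a)) + 1) / real b ^ Suc l))"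
  proof (intro sum.cong refl, clarify)
    fix n a assume "a \<in> A"
    hence "a < b" using A by auto
    \<comment> \<open>Appending the complementary digit lowers \<open>(n + 1) / b ^ l\<close> by
      exactly \<open>a / b ^ Suc l\<close>.\<close>
    hence "real (b * n + (b - 1 - a)) + 1 = real b * (real n + 1) - real a"
      by (simp add: of_nat_diff algebra_simps)
    hence "1 - (real n + 1) / real b ^ l + real a / real b ^ Suc l
             = 1 - (real (b * n + (b - 1 - a)) + 1) / real b ^ Suc l"
      using b by (simp add: diff_divide_distrib)
    thus "g (1 - (real n + 1) / real b ^ l + real a / real b ^ Suc l)
            = g (1 - (real (b * n + (b - 1 - a)) + 1) / real b ^ Suc l)" by (simp only:)
  qed
  also have "\<dots> = (\<Sum>n\<in>calB_below (Suc l). g (1 - (real n + 1) / real b ^ Suc l))"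
    by (subst sum.reindex_bij_betw[OF calB_below_Suc_bij, symmetric]) (simp add: case_prod_unfold)
  finally show ?case .
qed

text \<open>Count by length: passing from \<open>l\<close> to \<open>l + 1\<close> digits adds at
  most \<open>N ^ (l + 1)\<close> integers, all at least \<open>b ^ l\<close>, so their terms
  contribute at most \<open>N * q ^ l\<close>. The condition on \<open>\<sigma>\<close> says that
  \<open>q < 1\<close>.\<close>

lemma calB_powr_summable:
  assumes "\<sigma> > log b (card A)"
  shows "(\<lambda>n. (real n + 1) powr (- \<sigma>)) summable_on calB b A"
proof -
  define N where "N = real (card A)"
  define q where "q = N * real b powr (- \<sigma>)"
  have N: "N \<ge> 1" using A(2) by (simp add: N_def Suc_le_eq card_gt_0_iff)
  have "\<sigma> > 0" using assms N b order.strict_trans1[of 0 "log b N" \<sigma>] by (simp add: N_def)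
  have q: "0 \<le> q" "q < 1"
  proof -
    have "N = real b powr (log b N)" using N b by simp
    also have "\<dots> < real b powr \<sigma>" using assms b by (simp add: N_def)
    finally show "q < 1" using b by (simp add: q_def powr_minus field_simps)
    show "0 \<le> q" using N by (simp add: q_def)
  qed
  \<comment> \<open>The summand 1 is the term of \<open>n = 0\<close>, the only element of
    \<open>calB_below 0\<close>.\<close>
  have partial: "(\<Sum>n\<in>calB_below l. (real n + 1) powr (- \<sigma>)) \<le> 1 + N * (\<Sum>i<l. q ^ i)" for l
  proof (induction l)
    case (Suc l)
    let ?new = "calB_below (Suc l) - calB_below l"
    have "b ^ l \<le> b ^ Suc l" using b by (intro power_increasing) auto
    hence sub: "calB_below l \<subseteq> calB_below (Suc l)"
      by (auto simp: calB_below_def simp del: power_Suc)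
    have "(\<Sum>n\<in>?new. (real n + 1) powr (- \<sigma>)) \<le> of_nat (card ?new) * (real b ^ l) powr (- \<sigma>)"
    proof (rule sum_bounded_above)
      fix n assume "n \<in> ?new"
      hence "b ^ l \<le> n" by (auto simp: calB_below_def)
      hence "real b ^ l \<le> real n + 1" by (metis of_nat_le_iff of_nat_power add_increasing2 zero_le_one)
      thus "(real n + 1) powr (- \<sigma>) \<le> (real b ^ l) powr (- \<sigma>)"
        using b \<open>\<sigma> > 0\<close> by (intro powr_mono2') auto
    qed
    also have "\<dots> \<le> N ^ Suc l * (real b ^ l) powr (- \<sigma>)"
    proof (rule mult_right_mono)
      have "card ?new \<le> card (calB_below (Suc l))" by (rule card_mono) auto
      thus "of_nat (card ?new) \<le> N ^ Suc l"
        unfolding card_calB_below N_def of_nat_power[symmetric] of_nat_le_iff .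
    qed simp
    also have "\<dots> = N * q ^ l"
      using b by (simp add: q_def power_mult_distrib powr_power powr_realpow[symmetric] powr_powr mult.commute)
    finally have "(\<Sum>n\<in>?new. (real n + 1) powr (- \<sigma>)) \<le> N * q ^ l" .
    with Suc sum.subset_diff[OF sub, of "\<lambda>n. (real n + 1) powr (- \<sigma>)"] show ?case
      by (simp add: algebra_simps)
  qed (simp add: calB_below_0)
  have "(\<Sum>n\<in>X. (real n + 1) powr (- \<sigma>)) \<le> 1 + N * (1 / (1 - q))" if X: "finite X" "X \<subseteq> calB b A" for X
  proof -
    obtain l where l: "\<And>n. n \<in> X \<Longrightarrow> n \<le> l" using X(1) finite_nat_set_iff_bounded_le by auto
    have "X \<subseteq> calB_below l"
    proof
      fix n assume n: "n \<in> X"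
      have "n \<le> l" using l n by simp
      also have "l < b ^ l" by (rule power_gt_expt) (use b in simp)
      finally show "n \<in> calB_below l" using n X by (auto simp: calB_below_def)
    qed
    hence "(\<Sum>n\<in>X. (real n + 1) powr (- \<sigma>)) \<le> (\<Sum>n\<in>calB_below l. (real n + 1) powr (- \<sigma>))"
      by (intro sum_mono2) auto
    also have "\<dots> \<le> 1 + N * (\<Sum>i<l. q ^ i)" by (rule partial)
    also have "(\<Sum>i<l. q ^ i) \<le> 1 / (1 - q)"
      using q sum_le_suminf[of "\<lambda>i. q ^ i" "{..<l}"] suminf_geometric[of q] by (simp add: summable_geometric)
    hence "1 + N * (\<Sum>i<l. q ^ i) \<le> 1 + N * (1 / (1 - q))" using N by (intro add_left_mono mult_left_mono) auto
    finally show ?thesis by simp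
  qed
  thus ?thesis by (intro nonneg_bdd_above_summable_on bdd_aboveI2) auto
qed

end

section \<open>The asymptotics of the moments\<close>

text \<open>Extending \<open>(1 - y) powr m\<close> by 0 beyond \<open>y = 1\<close> lets the sums
  run over all \<open>j\<close> and \<open>n\<close>, with no side condition keeping the point in
  the unit interval.\<close>

definition truncated_power :: "real \<Rightarrow> real \<Rightarrow> real" where
  "truncated_power m y = (if y < 1 then (1 - y) powr m else 0)"

lemma truncated_power_nonneg: "0 \<le> truncated_power m y"
  by (simp add: truncated_power_def)

lemma truncated_power_le_exp:
  assumes "m > 0"
  shows "truncated_power m y \<le> exp (- (y * m))"
proof (cases "y < 1")
  case True
  have "(1 - y) powr m \<le> exp (- y) powr m"
    using exp_ge_add_one_self[of "- y"] True assms by (intro powr_mono2) auto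
  also have "\<dots> = exp (- (y * m))" by (simp add: powr_def mult.commute)
  finally show ?thesis using True by (simp add: truncated_power_def)
qed (simp add: truncated_power_def)

text \<open>For \<open>y \<le> 1 / 2\<close>, \<open>ln (1 - y) \<ge> - y - 2 * y\<^sup>2\<close>
  gives the lower bound \<open>(1 - 2 * m * y\<^sup>2) * exp (- (y * m))\<close>. For larger
  \<open>y\<close>, \<open>4 * m * y\<^sup>2\<close> is at least 1 and the bound is trivial. Written
  in terms of \<open>y * m\<close>, the error can be summed as a scale kernel with exponent raised
  by 2.\<close>

lemma truncated_power_diff_le:
  assumes m: "m \<ge> 1" and y: "y > 0"
  shows "\<bar>truncated_power m y - exp (- (y * m))\<bar> \<le> 4 / m * ((y * m)\<^sup>2 * exp (- (y * m)))"
proof -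
  have "exp (- (y * m)) - truncated_power m y \<le> 4 * (m * y\<^sup>2) * exp (- (y * m))"
  proof (cases "y \<le> 1 / 2")
    case True
    have "(1 - 2 * (m * y\<^sup>2)) * exp (- (y * m)) \<le> exp (- (2 * (m * y\<^sup>2))) * exp (- (y * m))"
      using exp_ge_add_one_self[of "- (2 * (m * y\<^sup>2))"] by (intro mult_right_mono) auto
    also have "\<dots> = exp (m * (- y - 2 * y\<^sup>2))"
      by (simp add: exp_add[symmetric] algebra_simps)
    also have "\<dots> \<le> exp (m * ln (1 - y))"
      using ln_one_minus_pos_lower_bound[of y] True y m by simp
    also have "\<dots> = truncated_power m y"
      using True by (simp add: truncated_power_def powr_def)
    finally have "exp (- (y * m)) - truncated_power m y \<le> 2 * (m * y\<^sup>2) * exp (- (y * m))"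
      by (simp add: algebra_simps)
    also have "\<dots> \<le> 4 * (m * y\<^sup>2) * exp (- (y * m))"
      using m by (intro mult_right_mono) auto
    finally show ?thesis .
  next
    case False
    have "1 * (1 / 2)\<^sup>2 \<le> m * y\<^sup>2"
      using m False by (intro mult_mono power_mono) auto
    hence "1 * exp (- (y * m)) \<le> 4 * (m * y\<^sup>2) * exp (- (y * m))"
      by (intro mult_right_mono) (auto simp: power2_eq_square)
    thus ?thesis using truncated_power_nonneg[of m y] by linarith
  qed
  also have "\<dots> = 4 / m * ((y * m)\<^sup>2 * exp (- (y * m)))"
    using m by (simp add: power2_eq_square)
  finally show ?thesis using truncated_power_le_exp[of m y] m by simp
qed

lemma of_real_powr_eq_exp:
  assumes "x > 0"
  shows "complex_of_real x powr z = exp (z * of_real (ln x))"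
  using assms by (simp add: powr_def Ln_of_real)

lemma of_nat_plus_1_powr: "(of_nat n + 1 :: complex) powr z = exp (z * of_real (ln (real n + 1)))"
  using of_real_powr_eq_exp[of "real n + 1" z] by simp

lemma norm_of_nat_plus_1_powr: "norm ((of_nat n + 1 :: complex) powr z) = (real n + 1) powr Re z"
  using norm_powr_real_powr[of "of_real (real n + 1)" z] by simp

text \<open>\<open>C\<close> does not depend on the shifts \<open>v\<close>. Since \<open>m\<close>
  will enter only through such shifts, this is the source of the uniformity in
  \<open>m\<close>.\<close>

lemma weighted_scale_kernel_summable:
  fixes w :: "nat \<Rightarrow> real" and R :: "nat set"
  assumes z: "\<beta> > 0" "Re z > 0" and w: "w summable_on R" "\<And>n. w n \<ge> 0"
  obtains C where
    "\<And>v. (\<lambda>(j::int, n). w n * norm (scale_kernel \<beta> z (of_int j + v n))) summable_on UNIV \<times> R"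
    "\<And>v. (\<Sum>\<^sub>\<infinity>(j::int, n)\<in>UNIV \<times> R. w n * norm (scale_kernel \<beta> z (of_int j + v n))) \<le> C"
proof -
  obtain C where C: "\<And>t. (\<Sum>\<^sub>\<infinity>j::int. norm (scale_kernel \<beta> z (of_int j + t))) \<le> C"
    using infsum_norm_scale_kernel_bounded[OF z] by blast
  show ?thesis
  proof
    fix v :: "nat \<Rightarrow> real"
    define f where "f n j = w n * norm (scale_kernel \<beta> z (of_int j + v n))" for n and j :: int
    define g where "g n = w n * (\<Sum>\<^sub>\<infinity>j::int. norm (scale_kernel \<beta> z (of_int j + v n)))" for n
    have fg: "(f n has_sum g n) UNIV" for n
      unfolding f_def g_def by (intro has_sum_cmult_right has_sum_infsum scale_kernel_abs_summable z)
    have g_le: "g n \<le> w n * C" for n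
      unfolding g_def by (intro mult_left_mono C w)
    have g: "g summable_on R"
      by (rule summable_on_comparison_test[OF summable_on_cmult_left[OF w(1), of C] g_le])
         (use w in \<open>auto simp: g_def intro!: mult_nonneg_nonneg infsum_nonneg\<close>)
    have f: "(\<lambda>(n, j). f n j) summable_on R \<times> UNIV"
    proof (rule summable_on_SigmaI[where g = g])
      show "0 \<le> (case (n, j) of (n, j) \<Rightarrow> f n j)" for n j
        using w by (simp add: f_def)
    qed (use fg g in simp_all)
    have "infsum g R = (\<Sum>\<^sub>\<infinity>n\<in>R. \<Sum>\<^sub>\<infinity>j. f n j)"
      using fg by (simp add: has_sum_iff)
    also have "\<dots> = (\<Sum>\<^sub>\<infinity>(n, j)\<in>R \<times> UNIV. f n j)"
      by (rule infsum_Sigma'_banach) (rule f)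
    finally have "((\<lambda>(n, j). f n j) has_sum infsum g R) (R \<times> UNIV)"
      using f by (simp add: has_sum_iff)
    hence sum: "((\<lambda>(j, n). f n j) has_sum infsum g R) (UNIV \<times> R)"
      by (subst (asm) has_sum_swap) (simp add: case_prod_unfold)
    show "(\<lambda>(j::int, n). w n * norm (scale_kernel \<beta> z (of_int j + v n))) summable_on UNIV \<times> R"
      using sum by (auto simp: f_def has_sum_iff)
    have "infsum g R \<le> (\<Sum>\<^sub>\<infinity>n\<in>R. w n * C)"
      by (intro infsum_mono g g_le summable_on_cmult_left w)
    thus "(\<Sum>\<^sub>\<infinity>(j::int, n)\<in>UNIV \<times> R. w n * norm (scale_kernel \<beta> z (of_int j + v n))) \<le> (\<Sum>\<^sub>\<infinity>n\<in>R. w n * C)"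
      using sum by (simp add: f_def has_sum_iff)
  qed
qed

section \<open>Fourier coefficients of \<open>F1\<close>\<close>

locale digit_moments = full_digits +
  fixes s :: complex
  assumes s: "Re s > log (real b) (real (card A))"
begin

abbreviation \<beta> :: real where "\<beta> \<equiv> ln (real b)"

abbreviation B :: "nat set" where "B \<equiv> calB b A"

definition dirichlet :: "complex \<Rightarrow> complex" where
  "dirichlet z = (\<Sum>\<^sub>\<infinity>n\<in>B. (of_nat n + 1) powr (- z))"

definition coeff :: "int \<Rightarrow> complex" where
  "coeff k = Gamma (wk b s k) * dirichlet (wk b s k) / of_real \<beta>"

lemma beta_pos: "\<beta> > 0"
  using b by simp

lemma Re_s_pos: "Re s > 0"
proof -
  have "log b (card A) \<ge> 0"
    using b A(2) by (simp add: Suc_le_eq card_gt_0_iff)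
  with s show ?thesis by linarith
qed

lemma wk_eq: "wk b s k = vertical_shift \<beta> s k"
  by (simp add: wk_def vertical_shift_def)

lemma Re_wk [simp]: "Re (wk b s k) = Re s"
  by (simp add: wk_eq)

lemma weight_summable: "(\<lambda>n. (real n + 1) powr (- Re s)) summable_on B"
  by (rule calB_powr_summable) (rule s)

lemma dirichlet_summable:
  assumes "Re z = Re s"
  shows "(\<lambda>n. (of_nat n + 1 :: complex) powr (- z)) summable_on B"
  by (rule summable_on_comparison_complex[OF weight_summable])
     (use assms in \<open>simp add: norm_of_nat_plus_1_powr\<close>)

lemma norm_dirichlet_le:
  assumes "Re z = Re s"
  shows "norm (dirichlet z) \<le> (\<Sum>\<^sub>\<infinity>n\<in>B. (real n + 1) powr (- Re s))"
  unfolding dirichlet_def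
  using norm_infsum_bound[of "\<lambda>n. (of_nat n + 1 :: complex) powr (- z)" B] weight_summable assms
  by (simp add: norm_of_nat_plus_1_powr)

text \<open>On the line of real part \<open>Re s\<close> the Dirichlet series is bounded by its
  value at \<open>Re s\<close>, so the decay of Gamma suffices.\<close>

lemma coeff_summable: "(\<lambda>k. (1 + \<bar>of_int k\<bar>) ^ r * norm (coeff k)) summable_on UNIV"
proof (rule summable_on_comparison_test)
  let ?Z = "\<Sum>\<^sub>\<infinity>n\<in>B. (real n + 1) powr (- Re s)"
  show "(\<lambda>k. (1 + \<bar>of_int k\<bar>) ^ r * norm (Gamma (vertical_shift \<beta> s k)) * (?Z / \<beta>)) summable_on UNIV"
    by (intro summable_on_cmult_left Gamma_vertical_shift_summable beta_pos Re_s_pos)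
  fix k :: int
  have "(1 + \<bar>of_int k\<bar>) ^ r * norm (Gamma (wk b s k)) * (norm (dirichlet (wk b s k)) / \<beta>)
         \<le> (1 + \<bar>of_int k\<bar>) ^ r * norm (Gamma (wk b s k)) * (?Z / \<beta>)"
    using beta_pos norm_dirichlet_le[of "wk b s k"] by (intro mult_left_mono divide_right_mono) auto
  thus "(1 + \<bar>of_int k\<bar>) ^ r * norm (coeff k) \<le> (1 + \<bar>of_int k\<bar>) ^ r * norm (Gamma (vertical_shift \<beta> s k)) * (?Z / \<beta>)"
    using beta_pos by (simp add: coeff_def norm_mult norm_divide wk_eq mult.assoc)
qed simp

lemma coeff_abs_summable: "(\<lambda>k. norm (coeff k)) summable_on UNIV"
  using coeff_summable[of 0] by simp

lemma F1_term_eq: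
  "exp (2 * of_real pi * \<i> * of_int k * of_real (log (real b) m)) * Gamma (wk b s k) *
     (\<Sum>\<^sub>\<infinity>n\<in>B. (of_nat n + 1) powr (- wk b s k)) = of_real \<beta> * (character k (log b m) * coeff k)"
  using beta_pos by (simp add: character_def coeff_def dirichlet_def)

lemma F1_eq_trig_series: "F1 b A s m = trig_series coeff (log b m)"
  unfolding F1_def F1_term_eq infsum_cmult_right' trig_series_def using beta_pos by simp

section \<open>The series \<open>F2\<close> on the logarithmic scale and its equality with
  \<open>F1\<close>\<close>

definition sample_point :: "real \<Rightarrow> nat \<Rightarrow> real" where
  "sample_point m n = log b ((real n + 1) * m)"

lemma exp_beta_sample_point:
  assumes "m > 0"
  shows "exp (\<beta> * (of_int j + sample_point m n)) = (real n + 1) * real b powr of_int j * m"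
proof -
  have "exp (\<beta> * (of_int j + sample_point m n)) = real b powr (of_int j) * exp (ln ((real n + 1) * m))"
    using b by (simp add: sample_point_def log_def powr_def exp_add ring_distribs mult.commute)
  thus ?thesis using assms by simp
qed

text \<open>At \<open>x = (n + 1) * b powr j * m\<close> the kernel is
  \<open>x powr s * exp (- x)\<close>; the weight \<open>(n + 1) powr (- s)\<close> removes the
  power of \<open>n + 1\<close> from it.\<close>

lemma F2_term_eq:
  assumes m: "m > 0"
  shows "complex_of_real m powr s * (of_nat b powr (of_int j * s) *
           of_real (exp (- ((real n + 1) * real b powr of_int j * m))))
         = (of_nat n + 1) powr (- s) * scale_kernel \<beta> s (of_int j + sample_point m n)"
proof -
  have "\<beta> * (c + x / \<beta>) = c * \<beta> + x" for c x
    using beta_pos by (simp add: field_simps)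
  hence "\<beta> * (of_int j + sample_point m n) = of_int j * \<beta> + ln ((real n + 1) * m)"
    by (simp only: sample_point_def log_def)
  also have "ln ((real n + 1) * m) = ln (real n + 1) + ln m"
    using m by (subst ln_mult) auto
  finally have "\<beta> * (of_int j + sample_point m n) = of_int j * \<beta> + ln (real n + 1) + ln m"
    by simp
  hence "scale_kernel \<beta> s (of_int j + sample_point m n)
          = exp (s * of_real (of_int j * \<beta> + ln (real n + 1) + ln m)
                 - of_real ((real n + 1) * real b powr of_int j * m))"
    using exp_beta_sample_point[OF m, of j n] by (simp add: scale_kernel_def mult.commute)
  moreover have "of_nat b powr (of_int j * s) = exp (of_int j * s * of_real \<beta>)"
    using of_real_powr_eq_exp[of "real b" "of_int j * s"] b by simp
  ultimately show ?thesis
    using of_real_powr_eq_exp[OF m, of s] of_nat_plus_1_powr[of n "- s"]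
    by (simp add: exp_of_real[symmetric] exp_add[symmetric] algebra_simps)
qed

lemma norm_scale_kernel_sample_point:
  assumes "m > 0"
  shows "norm (scale_kernel \<beta> z (of_int j + sample_point m n))
          = ((real n + 1) * real b powr of_int j * m) powr Re z * exp (- ((real n + 1) * real b powr of_int j * m))"
proof -
  define x where "x = (real n + 1) * real b powr of_int j * m"
  have x: "x > 0" using assms b by (simp add: x_def)
  have "\<beta> * (of_int j + sample_point m n) = ln x"
    using exp_beta_sample_point[OF assms, of j n] ln_exp x_def by metis
  thus ?thesis
    using x unfolding norm_scale_kernel x_def[symmetric] by (simp add: powr_def exp_diff exp_minus divide_inverse mult.commute)
qed

lemma kernel_family_summable:
  "(\<lambda>(j::int, n). (of_nat n + 1) powr (- s) * scale_kernel \<beta> s (of_int j + v n)) summable_on UNIV \<times> B"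
proof -
  obtain C where C: "\<And>v. (\<lambda>(j::int, n). (real n + 1) powr (- Re s) * norm (scale_kernel \<beta> s (of_int j + v n))) summable_on UNIV \<times> B"
    using weighted_scale_kernel_summable[OF beta_pos Re_s_pos weight_summable] by auto
  show ?thesis
    by (rule summable_on_comparison_complex[OF C[of v]])
       (auto simp: norm_mult norm_of_nat_plus_1_powr)
qed

text \<open>Merging the two exponentials of \<open>F2\<close> into one makes it a double series that
  can be compared termwise with the moments.\<close>

definition lattice_term :: "real \<Rightarrow> int \<Rightarrow> nat \<Rightarrow> complex" where
  "lattice_term m j n = of_nat b powr (of_int j * s) * of_real (exp (- ((real n + 1) * real b powr of_int j * m)))"

lemma lattice_term_summable:
  assumes "m > 0"
  shows "(\<lambda>(j, n). lattice_term m j n) summable_on UNIV \<times> B"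
proof -
  have "complex_of_real m powr s \<noteq> 0" using assms by simp
  moreover have "(\<lambda>(j, n). complex_of_real m powr s * lattice_term m j n) summable_on UNIV \<times> B"
    unfolding lattice_term_def F2_term_eq[OF assms] by (rule kernel_family_summable)
  ultimately show ?thesis
    using summable_on_cmult_right'[of "complex_of_real m powr s" "\<lambda>(j, n). lattice_term m j n" "UNIV \<times> B"]
    by (simp add: case_prod_unfold)
qed

lemma infsum_lattice_term:
  "(\<Sum>\<^sub>\<infinity>n\<in>B. lattice_term m j n) = of_nat b powr (of_int j * s) * of_real (exp (- (real b powr of_int j * m))) *
     (\<Sum>\<^sub>\<infinity>n\<in>B. of_real (exp (- (real n * real b powr of_int j * m))))"
proof -
  have "lattice_term m j n = of_nat b powr (of_int j * s) * of_real (exp (- (real b powr of_int j * m))) *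
          of_real (exp (- (real n * real b powr of_int j * m)))" for n
    by (simp add: lattice_term_def exp_add[symmetric] algebra_simps flip: of_real_mult)
  thus ?thesis by (simp only: infsum_cmult_right')
qed

lemma F2_eq: "F2 b A s m = complex_of_real m powr s * (\<Sum>\<^sub>\<infinity>j. \<Sum>\<^sub>\<infinity>n\<in>B. lattice_term m j n)"
  by (simp add: F2_def infsum_lattice_term)

lemma F2_eq_scale_sum:
  assumes "m > 0"
  shows "F2 b A s m = (\<Sum>\<^sub>\<infinity>n\<in>B. (of_nat n + 1) powr (- s) * scale_sum \<beta> s (sample_point m n))"
proof -
  have "F2 b A s m = (\<Sum>\<^sub>\<infinity>j. \<Sum>\<^sub>\<infinity>n\<in>B. (of_nat n + 1) powr (- s) * scale_kernel \<beta> s (of_int j + sample_point m n))"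
    unfolding F2_eq infsum_cmult_right'[symmetric] lattice_term_def F2_term_eq[OF assms] ..
  also have "\<dots> = (\<Sum>\<^sub>\<infinity>n\<in>B. \<Sum>\<^sub>\<infinity>j. (of_nat n + 1) powr (- s) * scale_kernel \<beta> s (of_int j + sample_point m n))"
    by (rule infsum_swap_banach) (rule kernel_family_summable)
  finally show ?thesis by (simp add: infsum_cmult_right' scale_sum_def)
qed

text \<open>Inside the character, \<open>log b (n + 1)\<close> splits off as the purely imaginary
  power of \<open>n + 1\<close> that turns the exponent \<open>- s\<close> into
  \<open>- wk b s k\<close>.\<close>

lemma character_sample_point:
  assumes "m > 0"
  shows "(of_nat n + 1) powr (- s) * character k (sample_point m n)
          = character k (log b m) * (of_nat n + 1) powr (- wk b s k)"
proof -
  have "sample_point m n = log b m + ln (real n + 1) / \<beta>"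
    using assms by (simp add: sample_point_def log_def ln_mult add_divide_distrib)
  thus ?thesis
    using beta_pos unfolding of_nat_plus_1_powr character_def wk_def
    by (simp add: exp_add[symmetric] algebra_simps)
qed

text \<open>With the Dirichlet series expanded, the double series is dominated by a product of the
  norms of the Gamma values and the weights \<open>(n + 1) powr (- Re s)\<close>. Summing over
  \<open>k\<close> first then gives the Fourier expansion of \<open>scale_sum\<close> at
  \<open>sample_point m n\<close>.\<close>

lemma F1_eq_F2:
  assumes "m > 0"
  shows "F1 b A s m = F2 b A s m"
proof -
  define f where "f k n = character k (log b m) * Gamma (wk b s k) / of_real \<beta> * (of_nat n + 1) powr (- wk b s k)" for k n
  have f: "(\<lambda>(k, n). f k n) summable_on UNIV \<times> B"
  proof -
    let ?g = "\<lambda>k. norm (Gamma (vertical_shift \<beta> s k))"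
    have g: "?g summable_on UNIV"
      using Gamma_vertical_shift_summable[OF beta_pos Re_s_pos, of 0] by simp
    have "(\<lambda>(k, n). ?g k / \<beta> * (real n + 1) powr (- Re s)) summable_on UNIV \<times> B"
    proof (rule summable_on_SigmaI)
      show "((\<lambda>n. case (k, n) of (k, n) \<Rightarrow> ?g k / \<beta> * (real n + 1) powr (- Re s)) has_sum
              (?g k / \<beta> * (\<Sum>\<^sub>\<infinity>n\<in>B. (real n + 1) powr (- Re s)))) B" for k
        unfolding prod.case by (intro has_sum_cmult_right has_sum_infsum weight_summable)
      show "(\<lambda>k. ?g k / \<beta> * (\<Sum>\<^sub>\<infinity>n\<in>B. (real n + 1) powr (- Re s))) summable_on UNIV"
        using summable_on_cmult_left[OF g, of "(\<Sum>\<^sub>\<infinity>n\<in>B. (real n + 1) powr (- Re s)) / \<beta>"] by simp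
    qed (use beta_pos in auto)
    thus ?thesis
      by (rule summable_on_comparison_complex)
         (use beta_pos in \<open>auto simp: f_def norm_mult norm_divide norm_of_nat_plus_1_powr wk_eq\<close>)
  qed
  have "F1 b A s m = (\<Sum>\<^sub>\<infinity>k. \<Sum>\<^sub>\<infinity>n\<in>B. f k n)"
    unfolding F1_eq_trig_series trig_series_def coeff_def dirichlet_def f_def infsum_cmult_right' by (simp add: mult_ac)
  also have "\<dots> = (\<Sum>\<^sub>\<infinity>n\<in>B. \<Sum>\<^sub>\<infinity>k. f k n)"
    by (rule infsum_swap_banach) (rule f)
  also have "\<dots> = (\<Sum>\<^sub>\<infinity>n\<in>B. (of_nat n + 1) powr (- s) * scale_sum \<beta> s (sample_point m n))"
  proof (rule infsum_cong)
    fix n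
    have "f k n = (of_nat n + 1) powr (- s) / of_real \<beta> * (character k (sample_point m n) * Gamma (vertical_shift \<beta> s k))" for k
      using character_sample_point[OF assms, of n k] by (simp add: f_def wk_eq[symmetric] mult_ac)
    hence "(\<Sum>\<^sub>\<infinity>k. f k n) = (of_nat n + 1) powr (- s) / of_real \<beta> *
             (\<Sum>\<^sub>\<infinity>k. character k (sample_point m n) * Gamma (vertical_shift \<beta> s k))"
      by (simp only: infsum_cmult_right')
    thus "(\<Sum>\<^sub>\<infinity>k. f k n) = (of_nat n + 1) powr (- s) * scale_sum \<beta> s (sample_point m n)"
      using scale_sum_fourier_expansion[OF beta_pos Re_s_pos, of "sample_point m n"] by simp
  qed
  finally show ?thesis using F2_eq_scale_sum[OF assms] by simp
qed

text \<open>Index \<open>j = - l\<close> stands for words of length \<open>l\<close>, and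
  \<open>(n + 1) * b powr j\<close> for the distance of the atom from 1; the indexing matches
  \<open>lattice_term\<close>.\<close>

definition moment_term :: "real \<Rightarrow> int \<Rightarrow> nat \<Rightarrow> complex" where
  "moment_term m j n = of_nat b powr (of_int j * s) * of_real (truncated_power m ((real n + 1) * real b powr of_int j))"

lemma moment_term_summable:
  assumes "m > 0"
  shows "(\<lambda>(j, n). moment_term m j n) summable_on UNIV \<times> B"
proof (rule summable_on_comparison_complex)
  show "(\<lambda>(j, n). norm (lattice_term m j n)) summable_on UNIV \<times> B"
    using lattice_term_summable[OF assms] by (simp add: summable_on_iff_abs_summable_on_complex case_prod_unfold)
  fix x :: "int \<times> nat" assume "x \<in> UNIV \<times> B"
  have "norm (moment_term m j n) \<le> norm (lattice_term m j n)" for j n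
    unfolding moment_term_def lattice_term_def norm_mult
    using truncated_power_le_exp[OF assms] truncated_power_nonneg by (intro mult_left_mono) auto
  thus "norm (case x of (j, n) \<Rightarrow> moment_term m j n) \<le> (case x of (j, n) \<Rightarrow> norm (lattice_term m j n))"
    by (simp add: case_prod_unfold)
qed

text \<open>Here \<open>(n + 1) * b powr j \<ge> 1\<close>, so truncation kills every term. This
  includes level 0, in accordance with \<open>rpow0 0 m = 0\<close> for
  \<open>m > 0\<close>.\<close>

lemma infsum_moment_term_nonneg:
  assumes "j \<ge> 0"
  shows "(\<Sum>\<^sub>\<infinity>n\<in>B. moment_term m j n) = 0"
proof -
  have "(real n + 1) * real b powr of_int j \<ge> 1 * 1" for n
    using b assms by (intro mult_mono ge_one_powr_ge_zero) auto
  hence "truncated_power m ((real n + 1) * real b powr of_int j) = 0" for n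
    using leD by (auto simp: truncated_power_def)
  hence "moment_term m j n = 0" for n
    by (simp add: moment_term_def)
  thus ?thesis by simp
qed

text \<open>Truncation discards all \<open>n \<ge> b ^ l\<close>; the remaining finite sum over
  \<open>calB_below l\<close> is the sum over words.\<close>

lemma infsum_moment_term_neg:
  assumes "m > 0"
  shows "(\<Sum>\<^sub>\<infinity>n\<in>B. moment_term m (- int l) n)
          = (\<Sum>w\<in>words A l. of_real (rpow0 (digit_val b w) m) * of_nat b powr (- (of_nat l * s)))"
proof -
  have pow: "real b powr of_int (- int l) = 1 / real b ^ l"
    using b by (simp add: powr_minus powr_realpow divide_inverse)
  have "(\<Sum>\<^sub>\<infinity>n\<in>B. moment_term m (- int l) n) = (\<Sum>\<^sub>\<infinity>n\<in>calB_below l. of_real (rpow0 (1 - (real n + 1) / real b ^ l) m) * of_nat b powr (- (of_nat l * s)))"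
  proof (rule infsum_cong_neutral)
    fix n assume "n \<in> B - calB_below l"
    hence "b ^ l \<le> n" by (auto simp: calB_below_def)
    hence "real b ^ l \<le> real n" by (metis of_nat_le_iff of_nat_power)
    hence "real b ^ l \<le> real n + 1" by linarith
    hence "real b ^ l / real b ^ l \<le> (real n + 1) / real b ^ l" by (rule divide_right_mono) simp
    hence "1 \<le> (real n + 1) / real b ^ l" using b by simp
    thus "moment_term m (- int l) n = 0"
      unfolding moment_term_def pow by (simp add: truncated_power_def)
  next
    fix n assume "n \<in> B \<inter> calB_below l"
    hence "n + 1 \<le> b ^ l" by (simp add: calB_below_def)
    hence "real (n + 1) \<le> real (b ^ l)" by (simp only: of_nat_le_iff)
    hence "(real n + 1) / real b ^ l \<le> 1" using b by (simp add: field_simps)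
    \<comment> \<open>At the boundary \<open>n + 1 = b ^ l\<close> both sides are 0, because
      \<open>m > 0\<close>.\<close>
    hence "truncated_power m ((real n + 1) / real b ^ l) = rpow0 (1 - (real n + 1) / real b ^ l) m"
      using assms by (auto simp: truncated_power_def rpow0_def)
    thus "moment_term m (- int l) n = of_real (rpow0 (1 - (real n + 1) / real b ^ l) m) * of_nat b powr (- (of_nat l * s))"
      unfolding moment_term_def pow by (simp add: mult.commute)
  qed (auto simp: calB_below_def)
  also have "\<dots> = (\<Sum>w\<in>words A l. of_real (rpow0 (digit_val b w) m) * of_nat b powr (- (of_nat l * s)))"
    using sum_words_eq_sum_calB_below[of "\<lambda>x. of_real (rpow0 x m) * of_nat b powr (- (of_nat l * s))" l] by simp
  finally show ?thesis .
qed

lemma moment_eq: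
  assumes "m > 0"
  shows "moment b A m s = (\<Sum>\<^sub>\<infinity>(j, n)\<in>UNIV \<times> B. moment_term m j n)"
proof -
  define h where "h j = (\<Sum>\<^sub>\<infinity>n\<in>B. moment_term m j n)" for j
  \<comment> \<open>The series in \<open>moment\<close> starts with words of length 1, hence the
    index \<open>- int (Suc l)\<close>.\<close>
  let ?i = "\<lambda>l. - int (Suc l)"
  have h: "h summable_on UNIV"
    unfolding h_def by (rule summable_on_Sigma_banach) (rule moment_term_summable[OF assms])
  have inj: "inj ?i" by (auto simp: inj_def)
  have "(h has_sum infsum h (range ?i)) (range ?i)"
    using summable_on_subset_banach[OF h] by (intro has_sum_infsum) auto
  hence "(\<lambda>l. h (?i l)) sums infsum h (range ?i)"
    by (subst (asm) has_sum_reindex[OF inj]) (auto simp: o_def intro: has_sum_imp_sums)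
  moreover have "infsum h (range ?i) = infsum h UNIV"
  proof (rule infsum_cong_neutral)
    fix j assume j: "j \<in> UNIV - range ?i"
    have "j \<ge> 0"
    proof (rule ccontr)
      assume "\<not> j \<ge> 0"
      hence "j = ?i (nat (- j - 1))" by simp
      with j show False by blast
    qed
    thus "h j = 0" by (simp add: h_def infsum_moment_term_nonneg)
  qed auto
  ultimately have "(\<Sum>l. h (?i l)) = infsum h UNIV" by (simp add: sums_iff)
  also have "\<dots> = (\<Sum>\<^sub>\<infinity>(j, n)\<in>UNIV \<times> B. moment_term m j n)"
    unfolding h_def by (rule infsum_Sigma'_banach) (rule moment_term_summable[OF assms])
  finally show ?thesis
    using assms unfolding h_def infsum_moment_term_neg[OF assms] by (simp add: moment_def rpow0_def)
qed

text \<open>The factor \<open>m powr Re s * b powr (j * Re s)\<close> equals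
  \<open>(n + 1) powr (- Re s) * (y * m) powr Re s\<close>, and the extra
  \<open>(y * m)\<^sup>2\<close> of the truncation estimate raises the kernel exponent to
  \<open>s + 2\<close>.\<close>

lemma norm_moment_term_diff_le:
  assumes "m \<ge> 1"
  shows "norm (complex_of_real m powr s * (moment_term m j n - lattice_term m j n))
          \<le> 4 / m * ((real n + 1) powr (- Re s) * norm (scale_kernel \<beta> (s + 2) (of_int j + sample_point m n)))"
proof -
  define y where "y = (real n + 1) * real b powr of_int j"
  have y: "y > 0" using b by (simp add: y_def)
  have b_norm: "norm (of_nat b powr (of_int j * s)) = real b powr (of_int j * Re s)"
    using norm_powr_real_powr[of "of_nat b" "of_int j * s"] by simp
  have "norm (complex_of_real m powr s * (moment_term m j n - lattice_term m j n))
          = m powr Re s * (real b powr (of_int j * Re s) * \<bar>truncated_power m y - exp (- (y * m))\<bar>)"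
    using assms by (simp add: moment_term_def lattice_term_def norm_mult b_norm norm_powr_real_powr y_def
                     flip: of_real_diff right_diff_distrib)
  also have "\<dots> \<le> m powr Re s * (real b powr (of_int j * Re s) * (4 / m * ((y * m)\<^sup>2 * exp (- (y * m)))))"
    by (intro mult_left_mono truncated_power_diff_le assms y) auto
  also have "m powr Re s * (real b powr (of_int j * Re s)) = (real n + 1) powr (- Re s) * (y * m) powr Re s"
  proof -
    have "(y * m) powr Re s = (real n + 1) powr Re s * real b powr (of_int j * Re s) * m powr Re s"
      by (simp only: y_def powr_mult powr_powr)
    moreover have "(real n + 1) powr (- Re s) * (real n + 1) powr Re s = 1"
      by (simp add: powr_add[symmetric])
    ultimately show ?thesis by (simp add: mult_ac)
  qed
  hence "m powr Re s * (real b powr (of_int j * Re s) * (4 / m * ((y * m)\<^sup>2 * exp (- (y * m)))))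
          = 4 / m * ((real n + 1) powr (- Re s) * (((y * m) powr Re s * (y * m)\<^sup>2) * exp (- (y * m))))"
    by (simp add: mult_ac)
  also have "(y * m) powr Re s * (y * m)\<^sup>2 = (y * m) powr Re (s + 2)"
    using y assms by (simp add: powr_add powr_numeral)
  also have "(y * m) powr Re (s + 2) * exp (- (y * m)) = norm (scale_kernel \<beta> (s + 2) (of_int j + sample_point m n))"
    using norm_scale_kernel_sample_point[of m "s + 2" j n] assms by (simp add: y_def)
  finally show ?thesis .
qed

text \<open>The termwise estimate is summed over all \<open>j\<close> and \<open>n\<close>, the
  kernel sum being bounded independently of \<open>m\<close>. The bound for every
  \<open>m \<ge> 1\<close> serves both the asymptotics and the averages.\<close>

lemma moment_asymptotics:
  obtains C where "\<And>m. m \<ge> 1 \<Longrightarrow> norm (complex_of_real m powr s * moment b A m s - F1 b A s m) \<le> C / m"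
proof -
  have "Re (s + 2) > 0" using Re_s_pos by simp
  from weighted_scale_kernel_summable[OF beta_pos this weight_summable] obtain C where
    C: "\<And>v. (\<lambda>(j::int, n). (real n + 1) powr (- Re s) * norm (scale_kernel \<beta> (s + 2) (of_int j + v n))) summable_on UNIV \<times> B"
    "\<And>v. (\<Sum>\<^sub>\<infinity>(j::int, n)\<in>UNIV \<times> B. (real n + 1) powr (- Re s) * norm (scale_kernel \<beta> (s + 2) (of_int j + v n))) \<le> C"
    by auto
  show ?thesis
  proof
    fix m :: real assume m: "m \<ge> 1"
    hence m0: "m > 0" by simp
    let ?d = "\<lambda>(j, n). complex_of_real m powr s * (moment_term m j n - lattice_term m j n)"
    let ?k = "\<lambda>(j::int, n). (real n + 1) powr (- Re s) * norm (scale_kernel \<beta> (s + 2) (of_int j + sample_point m n))"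
    have F: "F1 b A s m = complex_of_real m powr s * (\<Sum>\<^sub>\<infinity>(j, n)\<in>UNIV \<times> B. lattice_term m j n)"
      unfolding F1_eq_F2[OF m0] F2_eq using infsum_Sigma'_banach[OF lattice_term_summable[OF m0]] by simp
    have "((\<lambda>x. complex_of_real m powr s * ((case x of (j, n) \<Rightarrow> moment_term m j n) + - (case x of (j, n) \<Rightarrow> lattice_term m j n)))
            has_sum (complex_of_real m powr s * ((\<Sum>\<^sub>\<infinity>(j, n)\<in>UNIV \<times> B. moment_term m j n) + - (\<Sum>\<^sub>\<infinity>(j, n)\<in>UNIV \<times> B. lattice_term m j n)))) (UNIV \<times> B)"
      by (intro has_sum_cmult_right has_sum_add has_sum_uminusI has_sum_infsum moment_term_summable lattice_term_summable m0)
    hence d: "(?d has_sum (complex_of_real m powr s * moment b A m s - F1 b A s m)) (UNIV \<times> B)"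
      by (simp add: F moment_eq[OF m0] case_prod_unfold right_diff_distrib)
    have k: "((\<lambda>x. 4 / m * ?k x) has_sum (4 / m * infsum ?k (UNIV \<times> B))) (UNIV \<times> B)"
      by (intro has_sum_cmult_right has_sum_infsum C(1))
    have "norm (complex_of_real m powr s * moment b A m s - F1 b A s m) \<le> 4 / m * infsum ?k (UNIV \<times> B)"
    proof (rule norm_infsum_le[OF d k])
      show "norm (?d x) \<le> 4 / m * ?k x" for x
        using norm_moment_term_diff_le[OF m, of "fst x" "snd x"] by (simp add: case_prod_unfold)
    qed
    also have "\<dots> \<le> 4 / m * C"
      using m by (intro mult_left_mono C(2)) auto
    finally show "norm (complex_of_real m powr s * moment b A m s - F1 b A s m) \<le> 4 * C / m" by simp
  qed
qed

end

theorem theorem1: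
  fixes b :: nat and A :: "nat set" and s :: complex
  assumes hb: "b \<ge> 2"
    and hA: "A \<subseteq> {..<b}" and hne: "A \<noteq> {}"
    and hmax: "Max A = b - 1"
    and hs: "Re s > log (real b) (real (card A))"
  shows "(\<forall>k::int. (\<lambda>n. (of_nat n + 1) powr (- wk b s k)) summable_on calB b A) \<and>
    (\<forall>m>0. (\<lambda>k::int. exp (2 * of_real pi * \<i> * of_int k * of_real (log (real b) m)) *
                 Gamma (wk b s k) * (\<Sum>\<^sub>\<infinity>n\<in>calB b A. (of_nat n + 1) powr (- wk b s k)))
              summable_on UNIV) \<and>
    (\<forall>m>0. (\<lambda>j::int. (of_nat b) powr (of_int j * s) * complex_of_real (exp (- (real b powr of_int j * m))) *
                 (\<Sum>\<^sub>\<infinity>n\<in>calB b A. complex_of_real (exp (- (real n * real b powr of_int j * m)))))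
              summable_on UNIV) \<and>
    (\<forall>m>0. F1 b A s m = F2 b A s m) \<and>
    (\<forall>m>0. F1 b A s (real b * m) = F1 b A s m) \<and>
    (\<exists>D :: nat \<Rightarrow> real \<Rightarrow> complex. D 0 = (\<lambda>t. F1 b A s (real b powr t)) \<and>
           (\<forall>k t. (D k has_vector_derivative D (Suc k) t) (at t))) \<and>
    ((\<lambda>m. (complex_of_real m) powr s * moment b A m s - F1 b A s m)
           \<in> O(\<lambda>m. complex_of_real (1 / m))) \<and>
    ((\<lambda>p. \<Sum>m\<in>{b ^ p<..b ^ Suc p}.
             (of_nat m) powr s * moment b A (real m) s * complex_of_real (log (real b) (real m / (real m - 1))))
           \<longlonglongrightarrow> Gamma s / of_real (ln (real b)) * (\<Sum>\<^sub>\<infinity>n\<in>calB b A. (of_nat n + 1) powr (- s)))"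
proof (intro conjI)
  interpret digit_moments b A s
    by unfold_locales (use assms in auto)
  have F1: "F1 b A s = (\<lambda>m. trig_series coeff (log b m))"
    by (simp add: fun_eq_iff F1_eq_trig_series)
  \<comment> \<open>Since \<open>infsum\<close> is 0 by convention for a family that is not
    summable, the summability clauses ensure that the series in \<open>F1\<close> and
    \<open>F2\<close> are genuine sums.\<close>
  show "\<forall>k::int. (\<lambda>n. (of_nat n + 1) powr (- wk b s k)) summable_on calB b A"
    by (intro allI dirichlet_summable) simp
  show "\<forall>m>0. (\<lambda>k::int. exp (2 * of_real pi * \<i> * of_int k * of_real (log (real b) m)) *
                 Gamma (wk b s k) * (\<Sum>\<^sub>\<infinity>n\<in>calB b A. (of_nat n + 1) powr (- wk b s k)))
              summable_on UNIV"
    unfolding F1_term_eq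
    by (intro allI impI summable_on_cmult_right trig_series_summable coeff_abs_summable)
  show "\<forall>m>0. (\<lambda>j::int. (of_nat b) powr (of_int j * s) * complex_of_real (exp (- (real b powr of_int j * m))) *
                 (\<Sum>\<^sub>\<infinity>n\<in>calB b A. complex_of_real (exp (- (real n * real b powr of_int j * m)))))
              summable_on UNIV"
    unfolding infsum_lattice_term[symmetric]
    by (intro allI impI summable_on_Sigma_banach lattice_term_summable)
  show "\<forall>m>0. F1 b A s m = F2 b A s m"
    using F1_eq_F2 by blast
  show "\<forall>m>0. F1 b A s (real b * m) = F1 b A s m"
  proof (intro allI impI)
    fix m :: real assume "m > 0"
    hence "log b (real b * m) = log b m + 1" using hb by (simp add: log_mult)
    thus "F1 b A s (real b * m) = F1 b A s m" by (simp add: F1 trig_series_add_1)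
  qed
  have "(\<lambda>t. F1 b A s (real b powr t)) = trig_series coeff"
    using hb by (simp add: F1 fun_eq_iff)
  thus "\<exists>D :: nat \<Rightarrow> real \<Rightarrow> complex. D 0 = (\<lambda>t. F1 b A s (real b powr t)) \<and>
           (\<forall>k t. (D k has_vector_derivative D (Suc k) t) (at t))"
    using trig_series_smooth[OF coeff_summable] by metis
  obtain C where C: "\<And>m. m \<ge> 1 \<Longrightarrow> norm (complex_of_real m powr s * moment b A m s - F1 b A s m) \<le> C / m"
    using moment_asymptotics by blast
  show "(\<lambda>m. (complex_of_real m) powr s * moment b A m s - F1 b A s m) \<in> O(\<lambda>m. complex_of_real (1 / m))"
  proof (rule bigoI)
    show "eventually (\<lambda>m. norm (complex_of_real m powr s * moment b A m s - F1 b A s m)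
            \<le> C * norm (complex_of_real (1 / m))) at_top"
      using eventually_ge_at_top[of 1] by eventually_elim (use C in \<open>simp add: norm_divide\<close>)
  qed
  \<comment> \<open>As \<open>wk b s 0 = s\<close>, the constant Fourier coefficient is the claimed
    limit.\<close>
  have "coeff 0 = Gamma s / of_real (ln (real b)) * (\<Sum>\<^sub>\<infinity>n\<in>calB b A. (of_nat n + 1) powr (- s))"
    by (simp add: coeff_def dirichlet_def wk_def)
  moreover have "(\<lambda>p. \<Sum>m\<in>{b ^ p<..b ^ Suc p}.
             (of_nat m) powr s * moment b A (real m) s * complex_of_real (log (real b) (real m / (real m - 1)))) \<longlonglongrightarrow> coeff 0"
  proof (rule log_average_tendsto)
    show "norm (of_nat m powr s * moment b A (real m) s - trig_series coeff (log b m)) \<le> C / m"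
      if "m \<ge> 1" for m
      using C[of "real m"] that by (simp add: F1)
  qed (use hb coeff_summable[of 1] in auto)
  ultimately show "(\<lambda>p. \<Sum>m\<in>{b ^ p<..b ^ Suc p}.
             (of_nat m) powr s * moment b A (real m) s * complex_of_real (log (real b) (real m / (real m - 1))))
           \<longlonglongrightarrow> Gamma s / of_real (ln (real b)) * (\<Sum>\<^sub>\<infinity>n\<in>calB b A. (of_nat n + 1) powr (- s))"
    by simp
qed

end
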